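(* Let $n,k\in\mathbb N$, let $\theta$ be a threshold function, and consider either the MaxExp or the MaxProb objective. Suppose that the algorithm which, given any predicted prior $G$, runs the bi-criteria algorithm $\mathcal A(G,\theta)$, is $\alpha$-consistent and $\beta$-robust on instances with $nk$ values. Then there is an algorithm (namely the one that, given predicted prior $\tilde F$, samples $nk$ i.i.d. uniform times on $[0,1]$, sorts them as $t'_{11}<\dots<t'_{1k}<t'_{21}<\dots<t'_{nk}$, picks $s_i$ uniformly from $\{t'_{i1},\dots,t'_{ik}\}$ for each $i$, and accepts the $i$-th arriving value $x_i$, if nothing has been accepted yet, iff $x_i$ is best-so-far and $\tilde F(x_i)^{1/k}>\theta(s_i)$) that is $\alpha$-consistent and $\beta$-robust on instances with $n$ values.
   Context: Optimal stopping with a predicted prior (continuous-time model): $n$ values drawn i.i.d. from an unknown prior $F$, each with independent uniform arrival time in $[0,1]$, revealed in arrival order; an online algorithm (knowing $n$, a predicted prior $\tilde F$, the history, and internal randomness) irrevocably accepts at most one. Standing assumption: all priors (true and predicted) are continuous distributions with full support on $[0,\infty)$, identified with their cdfs. $x_{\mathrm{ALG}}$ is the accepted value ($0$ if none), $x_{\mathrm{OPT}}$ the maximum value. MaxExp ratio: $\mathbb E[x_{\mathrm{ALG}}]/\mathbb E[x_{\mathrm{OPT}}]$; MaxProb ratio: $\Pr[x_{\mathrm{ALG}}=x_{\mathrm{OPT}}]$. $\alpha$-consistent: $\alpha$-competitive for every $F$ when $\tilde F=F$; $\beta$-robust: $\beta$-competitive for every $F$ and every $\tilde F$. A threshold function is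 a non-increasing $\theta:[0,1]\to[0,1]$. The prefix maximum for time $t$ is the maximum of values arriving before $t$ ($0$ if none); a value is best-so-far if it is at least the prefix maximum for its arrival time. The bi-criteria algorithm $\mathcal A(G,\theta)$ accepts a value $x_i$ arriving at time $t_i$ (while nothing has been accepted) iff it is best-so-far and $G(x_i)>\theta(t_i)$. *)

theory Defs
  imports "HOL-Probability.Probability"
begin

datatype objective = MaxExp | MaxProb

text \<open>Priors: probability distributions on the reals, identified with their cdf,
  continuous, with full support on [0,inf): cdf 0 = 0 and cdf strictly increasing on [0,inf).\<close>
definition is_prior :: "real measure \<Rightarrow> bool" where
  "is_prior F \<longleftrightarrow> real_distribution F \<and> (\<forall>x. isCont (cdf F) x) \<and> cdf F 0 = 0
      \<and> strict_mono_on {0..} (cdf F)"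

definition is_threshold :: "(real \<Rightarrow> real) \<Rightarrow> bool" where
  "is_threshold \<theta> \<longleftrightarrow> (\<forall>a b. 0 \<le> a \<longrightarrow> a \<le> b \<longrightarrow> b \<le> 1 \<longrightarrow> \<theta> b \<le> \<theta> a)
      \<and> (\<forall>s. 0 \<le> s \<longrightarrow> s \<le> 1 \<longrightarrow> \<theta> s \<in> {0..1})"

text \<open>Instance with m values: x i is the i-th value, t i its arrival time (i < m).\<close>
definition prefix_max :: "nat \<Rightarrow> (nat \<Rightarrow> real) \<Rightarrow> (nat \<Rightarrow> real) \<Rightarrow> real \<Rightarrow> real" where
  "prefix_max m x t s = Max (insert 0 {x j | j. j < m \<and> t j < s})"

definition best_so_far :: "nat \<Rightarrow> (nat \<Rightarrow> real) \<Rightarrow> (nat \<Rightarrow> real) \<Rightarrow> nat \<Rightarrow> bool" where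
  "best_so_far m x t i \<longleftrightarrow> x i \<ge> prefix_max m x t (t i)"

text \<open>Value accepted by the online rule "accept the first arriving value satisfying elig"
  (0 if none). Ties in arrival times have probability zero.\<close>
definition accepted_value :: "nat \<Rightarrow> (nat \<Rightarrow> real) \<Rightarrow> (nat \<Rightarrow> real) \<Rightarrow> (nat \<Rightarrow> bool) \<Rightarrow> real" where
  "accepted_value m x t elig =
     (let A = {i. i < m \<and> elig i \<and> \<not> (\<exists>j<m. elig j \<and> t j < t i)}
      in if A = {} then 0 else Max (x ` A))"

definition opt_value :: "nat \<Rightarrow> (nat \<Rightarrow> real) \<Rightarrow> real" where
  "opt_value m x = Max (insert 0 (x ` {..<m}))"

definition unif01 :: "real measure" where
  "unif01 = uniform_measure lborel {0..1}"

definition instance_space :: "nat \<Rightarrow> real measure \<Rightarrow> ((nat \<Rightarrow> real) \<times> (nat \<Rightarrow> real)) measure" where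
  "instance_space m F = (PiM {..<m} (\<lambda>_. F)) \<Otimes>\<^sub>M (PiM {..<m} (\<lambda>_. unif01))"

definition competitive :: "objective \<Rightarrow> 'a measure \<Rightarrow> ('a \<Rightarrow> real) \<Rightarrow> ('a \<Rightarrow> real) \<Rightarrow> real \<Rightarrow> bool" where
  "competitive obj M ALG OPT c = (case obj of
      MaxExp \<Rightarrow> (\<integral>\<^sup>+ \<omega>. ennreal (ALG \<omega>) \<partial>M) \<ge> ennreal c * (\<integral>\<^sup>+ \<omega>. ennreal (OPT \<omega>) \<partial>M)
    | MaxProb \<Rightarrow> measure M {\<omega> \<in> space M. ALG \<omega> = OPT \<omega>} \<ge> c)"

definition bicrit_elig :: "nat \<Rightarrow> real measure \<Rightarrow> (real \<Rightarrow> real) \<Rightarrow> (nat \<Rightarrow> real) \<Rightarrow> (nat \<Rightarrow> real) \<Rightarrow> nat \<Rightarrow> bool" where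
  "bicrit_elig m G \<theta> x t i \<longleftrightarrow> best_so_far m x t i \<and> cdf G (x i) > \<theta> (t i)"

definition bicrit_competitive :: "objective \<Rightarrow> nat \<Rightarrow> (real \<Rightarrow> real) \<Rightarrow> real measure \<Rightarrow> real measure \<Rightarrow> real \<Rightarrow> bool" where
  "bicrit_competitive obj m \<theta> F G c =
     competitive obj (instance_space m F)
       (\<lambda>(x, t). accepted_value m x t (bicrit_elig m G \<theta> x t))
       (\<lambda>(x, t). opt_value m x) c"

text \<open>The reduced algorithm for n values (0-indexed): t' are n*k uniform times, c i uniform in
  {0..<k}; s_i is the (i*k + c i)-th smallest of the t'; the j-th value is paired with s_r where
  r is its arrival rank.\<close>
definition red_time :: "nat \<Rightarrow> nat \<Rightarrow> (nat \<Rightarrow> real) \<Rightarrow> (nat \<Rightarrow> nat) \<Rightarrow> nat \<Rightarrow> real" where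
  "red_time n k t' c i = sort (map t' [0..<n*k]) ! (i*k + c i)"

definition arrival_rank :: "nat \<Rightarrow> (nat \<Rightarrow> real) \<Rightarrow> nat \<Rightarrow> nat" where
  "arrival_rank n t j = card {j'. j' < n \<and> t j' < t j}"

definition red_elig :: "nat \<Rightarrow> nat \<Rightarrow> real measure \<Rightarrow> (real \<Rightarrow> real) \<Rightarrow> (nat \<Rightarrow> real) \<Rightarrow> (nat \<Rightarrow> real)
    \<Rightarrow> (nat \<Rightarrow> real) \<Rightarrow> (nat \<Rightarrow> nat) \<Rightarrow> nat \<Rightarrow> bool" where
  "red_elig n k G \<theta> x t t' c j \<longleftrightarrow> best_so_far n x t j
     \<and> cdf G (x j) powr (1 / real k) > \<theta> (red_time n k t' c (arrival_rank n t j))"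

definition red_space :: "nat \<Rightarrow> nat \<Rightarrow> real measure
    \<Rightarrow> (((nat \<Rightarrow> real) \<times> (nat \<Rightarrow> real)) \<times> ((nat \<Rightarrow> real) \<times> (nat \<Rightarrow> nat))) measure" where
  "red_space n k F = instance_space n F \<Otimes>\<^sub>M
     ((PiM {..<n*k} (\<lambda>_. unif01)) \<Otimes>\<^sub>M (PiM {..<n} (\<lambda>_. uniform_count_measure {..<k})))"

definition red_competitive :: "objective \<Rightarrow> nat \<Rightarrow> nat \<Rightarrow> (real \<Rightarrow> real) \<Rightarrow> real measure \<Rightarrow> real measure \<Rightarrow> real \<Rightarrow> bool" where
  "red_competitive obj n k \<theta> F G c =
     competitive obj (red_space n k F)
       (\<lambda>((x, t), (t', ch)). accepted_value n x t (red_elig n k G \<theta> x t t' ch))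
       (\<lambda>((x, t), _). opt_value n x) c"

end

theory Submission
  imports Defs
begin

text \<open>Write \<open>H\<close> for the prior with cdf \<open>F^(1/k)\<close>. Listing \<open>n*k\<close> draws from \<open>H\<close> in order of arrival and
  cutting the list into \<open>n\<close> consecutive blocks of length \<open>k\<close>, the block maxima are \<open>n\<close> independent
  draws from \<open>F\<close>, and their positions within the blocks are uniform and independent of them. Under
  this coupling the reduced algorithm runs on the block maxima, at the arrival times these have in the
  large instance. It stops in the same block as the bi-criteria algorithm with prediction
  \<open>G^(1/k)\<close> and takes the maximum of that block, while the overall maximum is the same; so it does at
  least as well for both objectives.\<close>

section \<open>Stopping rules in order of arrival\<close>

text \<open>The root is forced: the maximum of \<open>k\<close> independent draws has the
  \<open>k\<close>-th power of their cdf, so only draws with cdf \<open>F^(1/k)\<close> give blocks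
  of law \<open>F\<close>. Taking the same root of the prediction turns the test of the reduced
  algorithm into that of the bi-criteria algorithm, and a correct prediction stays correct, so
  consistency is inherited like robustness.

  The position of each block maximum is uniform and independent of the maxima because independent
  draws from one law are exchangeable. This is used in integrated form, by summing over all vectors
  of positions, without building a joint space.

  The remaining obstacle is measurability. A threshold function is arbitrary outside
  \<open>[0,1]\<close>, hence perhaps not Borel, and \<open>measure\<close> is 0 on non-measurable
  sets, so the winning probability of the reduced algorithm might vanish for formal reasons.
  Integrals are repaired by altering the threshold where times almost surely never fall. For MaxProb
  with a positive bound, the hypothesis itself certifies that the winning event of the large
  instance is measurable, and its sections give back as much measurability of \<theta> as the
  reduced algorithm uses.\<close>

lemma best_so_far_iff:
  "best_so_far m x t i \<longleftrightarrow> 0 \<le> x i \<and> (\<forall>j<m. t j < t i \<longrightarrow> x j \<le> x i)"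
proof -
  have "finite {x j | j. j < m \<and> t j < t i}"
    by (rule finite_subset[of _ "x ` {..<m}"]) auto
  then show ?thesis
    unfolding best_so_far_def prefix_max_def by (auto simp: Max_le_iff)
qed

lemma best_so_far_real_iff:
  "best_so_far m w real i \<longleftrightarrow> 0 \<le> w i \<and> (\<forall>j<m. j < i \<longrightarrow> w j \<le> w i)"
  by (simp add: best_so_far_iff)

lemma accepted_value_none:
  "(\<And>j. j < m \<Longrightarrow> \<not> e j) \<Longrightarrow> accepted_value m x t e = 0"
  by (auto simp: accepted_value_def Let_def)

lemma accepted_value_strictly_first:
  assumes "i < m" "e i" "\<And>j. j < m \<Longrightarrow> e j \<Longrightarrow> j \<noteq> i \<Longrightarrow> t i < t j"
  shows "accepted_value m x t e = x i"
proof -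
  have "{i. i < m \<and> e i \<and> \<not> (\<exists>j<m. e j \<and> t j < t i)} = {i}"
    using assms by force
  then show ?thesis by (simp add: accepted_value_def)
qed

lemma accepted_value_first:
  assumes inj: "inj_on t {..<m}" and i: "i < m" "e i" "\<And>j. j < m \<Longrightarrow> e j \<Longrightarrow> t i \<le> t j"
  shows "accepted_value m x t e = x i"
proof (rule accepted_value_strictly_first[of i m e, OF i(1,2)])
  fix j assume j: "j < m" "e j" "j \<noteq> i"
  then have "t i \<noteq> t j" using inj_onD[OF inj, of i j] i(1) by auto
  then show "t i < t j" using i(3)[OF j(1,2)] by simp
qed

lemma accepted_value_cong:
  assumes "\<And>i. i < m \<Longrightarrow> e i = e' i"
  shows "accepted_value m x t e = accepted_value m x t e'"
proof -
  have "{i. i < m \<and> e i \<and> \<not> (\<exists>j<m. e j \<and> t j < t i)} = {i. i < m \<and> e' i \<and> \<not> (\<exists>j<m. e' j \<and> t j < t i)}"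
    using assms by auto
  then show ?thesis by (simp add: accepted_value_def)
qed

lemma first_eligible_exists:
  fixes t :: "nat \<Rightarrow> real"
  assumes "j < m" "e j"
  obtains i where "i < m" "e i" "\<And>j. j < m \<Longrightarrow> e j \<Longrightarrow> t i \<le> t j"
proof -
  let ?S = "{j. j < m \<and> e j}"
  have "finite ?S" "?S \<noteq> {}" using assms by auto
  then have "arg_min_on t ?S \<in> ?S" "\<And>j. j \<in> ?S \<Longrightarrow> t (arg_min_on t ?S) \<le> t j"
    using arg_min_if_finite(1)[of ?S t] arg_min_least[of ?S] by blast+
  with that[of "arg_min_on t ?S"] show ?thesis by auto
qed

text \<open>A normal form for both algorithms: values are listed in order of arrival, so the
  embedding \<open>real\<close> of the indices serves as the arrival times. The second argument of
  \<open>Q\<close> is the position, through which a threshold taken at an order statistic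
  enters.\<close>

definition seq_value :: "nat \<Rightarrow> (nat \<Rightarrow> real) \<Rightarrow> (real \<Rightarrow> nat \<Rightarrow> bool) \<Rightarrow> real" where
  "seq_value m w Q = accepted_value m w real (\<lambda>l. best_so_far m w real l \<and> Q (w l) l)"

text \<open>Being best so far and being first among the eligible values depend on the times only
  through their order, so relabelling along an order isomorphism \<open>r\<close> carries one rule
  into the other. Injectivity of \<open>t\<close> excludes ties, which \<open>accepted_value\<close>
  would settle by a maximum.\<close>

lemma accepted_value_arrival_order:
  assumes inj: "inj_on t {..<m}" and bij: "bij_betw r {..<m} {..<m}"
    and ord: "\<And>i j. i < m \<Longrightarrow> j < m \<Longrightarrow> t i < t j \<longleftrightarrow> r i < r j"
    and z: "\<And>j. j < m \<Longrightarrow> z j = w (r j)"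
    and e: "\<And>j. j < m \<Longrightarrow> e j \<longleftrightarrow> best_so_far m z t j \<and> Q (z j) (r j)"
  shows "accepted_value m z t e = seq_value m w Q"
proof -
  define e' where "e' = (\<lambda>l. best_so_far m w real l \<and> Q (w l) l)"
  have img: "r ` {..<m} = {..<m}" using bij by (auto simp: bij_betw_def)
  have rlt: "r j < m" if "j < m" for j using img that by auto
  have b: "best_so_far m z t j \<longleftrightarrow> best_so_far m w real (r j)" if j: "j < m" for j
  proof -
    have "(\<forall>j'<m. t j' < t j \<longrightarrow> z j' \<le> z j) \<longleftrightarrow> (\<forall>j'\<in>{..<m}. r j' < r j \<longrightarrow> w (r j') \<le> w (r j))"
      using ord j z by auto
    also have "\<dots> \<longleftrightarrow> (\<forall>l\<in>r ` {..<m}. l < r j \<longrightarrow> w l \<le> w (r j))" by blast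
    finally show ?thesis unfolding best_so_far_iff img using z j by auto
  qed
  have e': "e j \<longleftrightarrow> e' (r j)" if "j < m" for j
    using that e b z by (simp add: e'_def)
  show ?thesis
  proof (cases "\<exists>j<m. e j")
    case False
    then have "\<not> e' l" if "l < m" for l
    proof -
      obtain j where "j < m" "l = r j" using img \<open>l < m\<close> by (metis imageE lessThan_iff)
      then show ?thesis using e' False by auto
    qed
    then show ?thesis using False
      unfolding seq_value_def e'_def[symmetric]
      by (simp add: accepted_value_none)
  next
    case True
    then obtain i where i: "i < m" "e i" "\<And>j. j < m \<Longrightarrow> e j \<Longrightarrow> t i \<le> t j"
      using first_eligible_exists by metis
    have "accepted_value m z t e = z i"
      by (rule accepted_value_first[where e = e, OF inj i])
    moreover have "accepted_value m w real e' = w (r i)"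
    proof (rule accepted_value_first)
      fix l assume "l < m" "e' l"
      moreover obtain j where "j < m" "l = r j" using img \<open>l < m\<close> by (metis imageE lessThan_iff)
      ultimately have "t i \<le> t j" using e' i by auto
      then have "\<not> r j < r i" using ord[of j i] \<open>j < m\<close> i(1) by auto
      then show "real (r i) \<le> real l" using \<open>l = r j\<close> by simp
    qed (use i e' rlt in \<open>auto simp: inj_on_def\<close>)
    ultimately show ?thesis using z i(1) by (simp add: seq_value_def e'_def)
  qed
qed

section \<open>Arrival ranks and order statistics of the times\<close>

lemma arrival_rank_less_iff:
  assumes "i < m" "j < m"
  shows "t i < t j \<longleftrightarrow> arrival_rank m t i < arrival_rank m t j"
proof -
  have fin: "finite {j'. j' < m \<and> t j' < s}" for s by auto
  have 1: "arrival_rank m t a < arrival_rank m t b" if "t a < t b" "a < m" for a b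
    unfolding arrival_rank_def using that by (intro psubset_card_mono fin) auto
  have 2: "arrival_rank m t b \<le> arrival_rank m t a" if "\<not> t a < t b" for a b
    unfolding arrival_rank_def using that by (intro card_mono fin) auto
  show ?thesis using 1[of i j] 2[of i j] assms by fastforce
qed

lemma arrival_rank_less: "j < m \<Longrightarrow> arrival_rank m t j < m"
proof -
  assume "j < m"
  then have "card {j'. j' < m \<and> t j' < t j} < card {..<m}"
    by (intro psubset_card_mono) auto
  then show ?thesis by (simp add: arrival_rank_def)
qed

lemma bij_arrival_rank:
  assumes "inj_on t {..<m}"
  shows "bij_betw (arrival_rank m t) {..<m} {..<m}"
proof -
  have inj: "inj_on (arrival_rank m t) {..<m}"
  proof (rule inj_onI)
    fix i j assume ij: "i \<in> {..<m}" "j \<in> {..<m}" "arrival_rank m t i = arrival_rank m t j"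
    then have "t i = t j"
      using arrival_rank_less_iff[of i m j t] arrival_rank_less_iff[of j m i t] by simp
    then show "i = j" using assms ij by (auto dest: inj_onD)
  qed
  moreover have "arrival_rank m t ` {..<m} \<subseteq> {..<m}"
    using arrival_rank_less by auto
  ultimately show ?thesis
    by (simp add: bij_betw_def endo_inj_surj)
qed

text \<open>For a downward closed \<open>P\<close> the entries satisfying \<open>P\<close> form an
  initial segment of the sorted list, and its length can be counted in the unsorted one.\<close>

lemma sort_nth_iff:
  fixes xs :: "real list"
  assumes i: "i < length xs" and P: "\<And>a b. a \<le> b \<Longrightarrow> P b \<Longrightarrow> P a"
  shows "P (sort xs ! i) \<longleftrightarrow> i < length (filter P xs)"
proof -
  let ?ys = "sort xs" and ?J = "{j. j < length (sort xs) \<and> P (sort xs ! j)}"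
  have len: "length (filter P xs) = card ?J"
    by (simp only: length_filter_conv_card[symmetric]) (simp add: filter_sort)
  have mono: "?ys ! a \<le> ?ys ! b" if "a \<le> b" "b < length xs" for a b
    using that by (intro sorted_nth_mono) auto
  show ?thesis
  proof (cases "P (?ys ! i)")
    case True
    then have "{..i} \<subseteq> ?J" using i mono P by auto
    then have "card {..i} \<le> card ?J" by (intro card_mono) auto
    then show ?thesis using True len by simp
  next
    case False
    have "?J \<subseteq> {..<i}"
    proof
      fix j assume "j \<in> ?J"
      then show "j \<in> {..<i}" using mono[of i j] P[of "?ys ! i" "?ys ! j"] False by (auto simp: not_less[symmetric])
    qed
    then have "card ?J \<le> card {..<i}" by (intro card_mono) auto
    then show ?thesis using False len by simp
  qed
qed

lemma length_filter_map_upt: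
  "length (filter P (map t [0..<m])) = card {j. j < m \<and> P (t j)}"
  by (simp add: length_filter_conv_card cong: conj_cong)

text \<open>This lets the bi-criteria threshold at an arrival time be read off from the rank and the
  order statistics. The rank counts the strictly smaller times, so it is the right index for
  counting from 0: comparing it with the numbers of times \<open>< t j\<close> and
  \<open>\<le> t j\<close> pins the entry from both sides.\<close>

lemma sort_nth_arrival_rank:
  assumes "j < m"
  shows "sort (map t [0..<m]) ! arrival_rank m t j = t j"
proof -
  have r: "arrival_rank m t j < length (map t [0..<m])"
    using arrival_rank_less[OF assms] by simp
  have "\<not> sort (map t [0..<m]) ! arrival_rank m t j < t j"
    by (subst sort_nth_iff[OF r, of "\<lambda>a. a < t j"])
       (auto simp only: length_filter_map_upt, simp add: arrival_rank_def)
  moreover have "card {i. i < m \<and> t i < t j} < card {i. i < m \<and> t i \<le> t j}"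
    using assms by (intro psubset_card_mono) auto
  then have "sort (map t [0..<m]) ! arrival_rank m t j \<le> t j"
    by (subst sort_nth_iff[OF r, of "\<lambda>a. a \<le> t j"])
       (auto simp only: length_filter_map_upt, simp add: arrival_rank_def)
  ultimately show ?thesis by simp
qed

lemma seq_value_cases:
  obtains "\<And>j. j < m \<Longrightarrow> \<not> (best_so_far m w real j \<and> Q (w j) j)" "seq_value m w Q = 0"
  | i where "i < m" "best_so_far m w real i" "Q (w i) i"
      "\<And>j. j < m \<Longrightarrow> best_so_far m w real j \<Longrightarrow> Q (w j) j \<Longrightarrow> i \<le> j" "seq_value m w Q = w i"
proof (cases "\<exists>j<m. best_so_far m w real j \<and> Q (w j) j")
  case True
  then obtain i where i: "i < m" "best_so_far m w real i \<and> Q (w i) i"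
      "\<And>j. j < m \<Longrightarrow> best_so_far m w real j \<and> Q (w j) j \<Longrightarrow> real i \<le> real j"
    using first_eligible_exists[where t = real and e = "\<lambda>j. best_so_far m w real j \<and> Q (w j) j"]
    by metis
  then have "seq_value m w Q = w i"
    unfolding seq_value_def by (intro accepted_value_first) (auto simp: inj_on_def)
  with i show ?thesis by (intro that(2)[of i]) auto
next
  case False
  then show ?thesis by (intro that(1)) (auto simp: seq_value_def intro: accepted_value_none)
qed

lemma seq_value_le_opt: "seq_value m w Q \<le> opt_value m w"
  by (cases m w Q rule: seq_value_cases) (auto simp: opt_value_def)

section \<open>Block maxima\<close>

lemma block_index_less:
  fixes n k i l :: nat
  assumes "i < n" "l < k"
  shows "i * k + l < n * k"
proof -
  have "i * k + l < Suc i * k" using assms by simp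
  also have "\<dots> \<le> n * k" using assms by (intro mult_le_mono1) simp
  finally show ?thesis .
qed

lemma block_decompose:
  fixes n k p :: nat
  assumes "p < n * k"
  obtains i l where "i < n" "l < k" "p = i * k + l"
proof -
  have "0 < k" using assms by (cases k) auto
  then show ?thesis using assms
    by (intro that[of "p div k" "p mod k"]) (auto simp: less_mult_imp_div_less)
qed

lemma block_index_mono:
  fixes i j k a b :: nat
  assumes "i * k + a \<le> j * k + b" "b < k"
  shows "i \<le> j"
proof (rule ccontr)
  assume "\<not> i \<le> j"
  then have "Suc j * k \<le> i * k" by (intro mult_le_mono1) simp
  then show False using assms by simp
qed

text \<open>A relation rather than a choice of maximiser: for fixed \<open>c\<close> it is an event
  in \<open>w\<close>, and integrals are split along these events. They overlap only at
  ties.\<close>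

definition is_block_argmax :: "nat \<Rightarrow> nat \<Rightarrow> (nat \<Rightarrow> real) \<Rightarrow> (nat \<Rightarrow> nat) \<Rightarrow> bool" where
  "is_block_argmax n k w c \<longleftrightarrow>
     (\<forall>i<n. c i < k \<and> (\<forall>l<k. w (i * k + l) \<le> w (i * k + c i)))"

definition block_max :: "nat \<Rightarrow> nat \<Rightarrow> (nat \<Rightarrow> real) \<Rightarrow> nat \<Rightarrow> real" where
  "block_max n k w = (\<lambda>i\<in>{..<n}. Max ((\<lambda>l. w (i * k + l)) ` {..<k}))"

lemma block_max_eq_argmax:
  assumes "is_block_argmax n k w c" "i < n"
  shows "block_max n k w i = w (i * k + c i)"
  using assms unfolding is_block_argmax_def block_max_def
  by (auto intro!: Max_eqI)

lemma opt_value_block_max: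
  assumes c: "is_block_argmax n k w c"
  shows "opt_value n (block_max n k w) = opt_value (n * k) w"
proof (rule order.antisym)
  have c': "c i < k" "l < k \<Longrightarrow> w (i * k + l) \<le> w (i * k + c i)" if "i < n" for i l
    using c that by (auto simp: is_block_argmax_def)
  have "block_max n k w i \<le> opt_value (n * k) w" if "i < n" for i
    unfolding block_max_eq_argmax[OF c that] opt_value_def
    using block_index_less[OF that c'(1)[OF that]] by (intro Max_ge) auto
  then show "opt_value n (block_max n k w) \<le> opt_value (n * k) w"
    by (subst opt_value_def) (auto simp: opt_value_def)
  have "w p \<le> opt_value n (block_max n k w)" if p: "p < n * k" for p
  proof -
    obtain i l where il: "i < n" "l < k" "p = i * k + l" using p by (rule block_decompose)
    then have "w p \<le> block_max n k w i" using c' block_max_eq_argmax[OF c] by simp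
    also have "\<dots> \<le> opt_value n (block_max n k w)" using il by (simp add: opt_value_def)
    finally show ?thesis .
  qed
  then show "opt_value (n * k) w \<le> opt_value n (block_max n k w)"
    by (subst opt_value_def) (auto simp: opt_value_def)
qed

text \<open>Once a value is eligible, the maximum of its block is eligible too, since it comes no earlier
  and is no smaller; conversely an eligible block maximum is itself eligible in the finer sequence.
  So both rules stop in the same block, and the block rule takes the larger value.\<close>
lemma seq_value_le_block:
  assumes c: "is_block_argmax n k w c" and inj: "inj_on w {..<n * k}"
    and Q: "\<And>v v' l l'. Q v l \<Longrightarrow> v \<le> v' \<Longrightarrow> l \<le> l' \<Longrightarrow> l' < n * k \<Longrightarrow> Q v' l'"
  shows "seq_value (n * k) w Q \<le> seq_value n (block_max n k w) (\<lambda>v i. Q v (i * k + c i))"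
proof -
  let ?y = "block_max n k w" and ?R = "\<lambda>v i. Q v (i * k + c i)"
  let ?B = "\<lambda>p. best_so_far (n * k) w real p \<and> Q (w p) p"
  let ?E = "\<lambda>i. best_so_far n ?y real i \<and> ?R (?y i) i"
  have c': "c i < k" "l < k \<Longrightarrow> w (i * k + l) \<le> w (i * k + c i)" if "i < n" for i l
    using c that by (auto simp: is_block_argmax_def)
  have cl: "i * k + c i < n * k" if "i < n" for i
    using block_index_less c' that by blast
  have y: "?y i = w (i * k + c i)" if "i < n" for i
    by (rule block_max_eq_argmax[OF c that])
  have up: "?E i \<and> w (i * k + l) \<le> ?y i" if il: "i < n" "l < k" and B: "?B (i * k + l)" for i l
  proof -
    have wle: "w (i * k + l) \<le> ?y i" using il c' y by auto
    have w0: "0 \<le> w (i * k + l)" and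
      best: "\<And>q. q < i * k + l \<Longrightarrow> w q \<le> w (i * k + l)"
      using B block_index_less[OF il] unfolding best_so_far_real_iff by auto
    \<comment> \<open>A best-so-far value arriving after the block maximum would have to equal it,
      which injectivity forbids. Hence the maximum comes no earlier, and \<open>Q\<close> may be
      pushed forward to its position.\<close>
    have lc: "l \<le> c i"
    proof (rule ccontr)
      assume "\<not> l \<le> c i"
      then have "w (i * k + c i) \<le> w (i * k + l)" by (intro best) simp
      then have "w (i * k + c i) = w (i * k + l)" using wle y il by simp
      then have "i * k + c i = i * k + l"
        by (rule inj_onD[OF inj]) (use cl[OF il(1)] block_index_less[OF il] in auto)
      with \<open>\<not> l \<le> c i\<close> show False by simp
    qed
    have "best_so_far n ?y real i"
      unfolding best_so_far_real_iff
    proof (intro conjI allI impI)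
      fix j assume "j < n" "j < i"
      then have "j * k + c j < i * k" using c' block_index_less[of j i "c j" k] by simp
      then have "?y j \<le> w (i * k + l)" using y \<open>j < n\<close> by (simp add: best)
      then show "?y j \<le> ?y i" using wle by simp
    qed (use w0 wle in simp)
    moreover have "?R (?y i) i"
      using Q[OF conjunct2[OF B] wle _ cl[OF il(1)]] lc by simp
    ultimately show ?thesis using wle by simp
  qed
  have down: "?B (i * k + c i)" if i: "i < n" and E: "?E i" for i
  proof -
    have "w q \<le> w (i * k + c i)" if q: "q < i * k + c i" for q
    proof -
      have "q < n * k" using q cl[OF i] by simp
      then obtain j l where jl: "j < n" "l < k" "q = j * k + l" by (rule block_decompose)
      have "j \<le> i" using q jl c'(1)[OF i] block_index_mono[of j k l i "c i"] by simp
      have "w q \<le> ?y j" using jl c' y by simp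
      also have "\<dots> \<le> ?y i"
        using E \<open>j \<le> i\<close> jl(1) by (cases "j = i") (auto simp: best_so_far_real_iff)
      finally show ?thesis using y i by simp
    qed
    then show ?thesis using E y[OF i] by (auto simp: best_so_far_real_iff)
  qed
  show ?thesis
  proof (cases n ?y ?R rule: seq_value_cases)
    case 1
    have "\<not> ?B p" if "p < n * k" for p
      using block_decompose[OF that] up 1(1) by metis
    then have "seq_value (n * k) w Q = 0"
      unfolding seq_value_def by (intro accepted_value_none)
    with 1 show ?thesis by simp
  next
    case (2 i)
    show ?thesis
    proof (cases "n * k" w Q rule: seq_value_cases)
      case 1
      then show ?thesis using down[of i] 2 cl[of i] by blast
    next
      case p: (2 p)
      obtain j l where jl: "j < n" "l < k" "p = j * k + l" using p(1) by (rule block_decompose)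
      have "i \<le> j" and wy: "w p \<le> ?y j" using up[of j l] jl p 2 by auto
      have "p \<le> i * k + c i" using p(4)[of "i * k + c i"] down[of i] 2 cl[of i] by blast
      then have "j \<le> i" using jl c'(1)[OF 2(1)] block_index_mono[of j k l i "c i"] by simp
      with \<open>i \<le> j\<close> wy p 2 show ?thesis by simp
    qed
  qed
qed


section \<open>Laws of values, times and block maxima\<close>

lemma is_priorD:
  assumes "is_prior F"
  shows "prob_space F" "sets F = sets borel" "emeasure F {a} = 0"
proof -
  interpret real_distribution F using assms by (simp add: is_prior_def)
  show "prob_space F" "sets F = sets borel" by unfold_locales (simp)
  show "emeasure F {a} = 0"
    using assms isCont_cdf[of a] by (simp add: is_prior_def emeasure_eq_measure)
qed

lemma cdf_prior_nonpos:
  assumes "is_prior F" "x \<le> 0"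
  shows "cdf F x = 0"
proof -
  interpret real_distribution F using assms by (simp add: is_prior_def)
  show ?thesis
    using cdf_nondecreasing[OF assms(2)] cdf_nonneg[of x] assms by (simp add: is_prior_def)
qed

text \<open>Gives access to \<open>root\<close>, which is continuous and strictly increasing at 0 as
  well.\<close>

lemma powr_inverse_nat_eq_root:
  assumes "0 < k" "0 \<le> x"
  shows "x powr (1 / real k) = root k x"
  using assms by (cases "x = 0") (auto simp: root_powr_inverse)

text \<open>The \<open>k\<close>-th root is continuous, strictly increasing and fixes 0 and 1, so it
  preserves every requirement on a prior. Thus the assumptions on the large instance, which quantify
  over priors, apply to the roots of \<open>F\<close> and \<open>G\<close>.\<close>

lemma root_prior_exists:
  assumes F: "is_prior F" and k: "0 < k"
  obtains H where "is_prior H" "\<And>x. cdf H x = cdf F x powr (1 / real k)"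
proof -
  interpret real_distribution F using F by (simp add: is_prior_def)
  define f where "f = (\<lambda>x. root k (cdf F x))"
  have f: "cdf F x powr (1 / real k) = f x" for x
    unfolding f_def by (rule powr_inverse_nat_eq_root[OF k cdf_nonneg])
  have mono: "f x \<le> f y" if "x \<le> y" for x y
    using that k by (simp add: f_def cdf_nondecreasing)
  have cont: "isCont f x" for x
    unfolding f_def using F by (intro isCont_o2[OF _ isCont_real_root]) (auto simp: is_prior_def)
  have rc: "continuous (at_right a) f" for a
    using cont by (rule continuous_at_imp_continuous_at_within)
  have bot: "(f \<longlongrightarrow> 0) at_bot"
  proof (rule tendsto_eventually)
    show "eventually (\<lambda>x. f x = 0) at_bot"
      unfolding eventually_at_bot_linorder f_def
      using cdf_prior_nonpos[OF F] by (intro exI[of _ 0]) auto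
  qed
  have top: "(f \<longlongrightarrow> 1) at_top"
    using tendsto_real_root[OF cdf_lim_at_top_prob, of k] k by (simp add: f_def)
  have rd: "real_distribution (interval_measure f)"
    by (rule real_distribution_interval_measure[OF mono rc bot top])
  have cdf: "cdf (interval_measure f) = f"
    by (rule cdf_interval_measure[OF mono rc bot])
  have "strict_mono_on {0..} f"
    using F k unfolding is_prior_def f_def strict_mono_on_def by auto
  moreover have "f 0 = 0" using cdf_prior_nonpos[OF F, of 0] by (simp add: f_def)
  ultimately have "is_prior (interval_measure f)"
    using rd cdf cont by (simp add: is_prior_def)
  then show ?thesis using cdf f by (intro that) auto
qed

section \<open>Independent draws from a law without atoms\<close>

lemma prob_space_unif01: "prob_space unif01"
  unfolding unif01_def by (rule prob_space_uniform_measure) auto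

lemma sets_unif01: "sets unif01 = sets borel"
  by (simp add: unif01_def)

lemma emeasure_unif01_singleton: "emeasure unif01 {a} = 0"
proof -
  have "emeasure lborel ({0..1} \<inter> {a}) \<le> emeasure lborel {a}"
    by (rule emeasure_mono) auto
  then show ?thesis by (simp add: unif01_def)
qed

lemma AE_unif01: "AE s in unif01. s \<in> {0..1}"
  unfolding unif01_def by (rule AE_uniform_measureI) auto

text \<open>The joint map of all coordinates is the identity on the product space, so its law is the
  product of the marginals, which characterises independence over a nonempty index set.\<close>

lemma indep_vars_PiM_coordinates:
  assumes D: "prob_space D" and I: "I \<noteq> {}"
  shows "prob_space.indep_vars (PiM I (\<lambda>_. D)) (\<lambda>_. D) (\<lambda>i \<omega>. \<omega> i) I"
proof -
  interpret product_prob_space "\<lambda>_. D" I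
    using D by (simp add: product_prob_space_def product_prob_space_axioms_def product_sigma_finite_def prob_space_imp_sigma_finite)
  have "distr (PiM I (\<lambda>_. D)) (PiM I (\<lambda>_. D)) (\<lambda>x. \<lambda>i\<in>I. x i) = PiM I (\<lambda>_. D)"
    by (subst distr_cong[OF refl refl, of _ _ "\<lambda>x. x"])
       (auto simp: space_PiM PiE_restrict distr_id2)
  also have "\<dots> = (\<Pi>\<^sub>M i\<in>I. distr (PiM I (\<lambda>_. D)) D (\<lambda>\<omega>. \<omega> i))"
    by (intro PiM_cong) (auto simp: PiM_component)
  finally show ?thesis
    by (subst P.indep_vars_iff_distr_eq_PiM'[OF I]) auto
qed

text \<open>Two distinct coordinates have joint law \<open>D\<close> times \<open>D\<close>. By
  Fubini the diagonal is null, since its sections are single points and \<open>D\<close> has no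
  atoms; only finitely many pairs occur. Applied to the values and to the arrival times.\<close>

lemma AE_PiM_inj_on:
  fixes D :: "real measure"
  assumes D: "prob_space D" and sets_D[measurable_cong]: "sets D = sets borel"
    and no_atom: "\<And>a. emeasure D {a} = 0"
  shows "AE w in PiM {..<m::nat} (\<lambda>_. D). inj_on w {..<m}"
proof -
  let ?P = "PiM {..<m} (\<lambda>_. D)"
  interpret D: prob_space D by fact
  interpret P: prob_space ?P by (intro prob_space_PiM D)
  interpret DD: pair_sigma_finite D D ..
  have DD_ne: "AE z in D \<Otimes>\<^sub>M D. fst z \<noteq> snd z"
  proof (rule DD.AE_pair_measure)
    have "AE y in D. y \<noteq> a" for a
      by (rule AE_I[of _ _ "{a}"]) (auto simp: no_atom sets_D)
    then have "AE y in D. a \<noteq> y" for a using eventually_mono[of "\<lambda>y. y \<noteq> a" "ae_filter D"] by auto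
    then show "AE x in D. AE y in D. fst (x, y) \<noteq> snd (x, y)" by simp
  qed measurable
  have "AE w in ?P. w i \<noteq> w j" if ij: "i < m" "j < m" "i \<noteq> j" for i j
  proof -
    have "P.indep_vars (\<lambda>_. D) (\<lambda>i \<omega>. \<omega> i) {..<m}"
      by (rule indep_vars_PiM_coordinates[OF D]) (use ij in auto)
    then have "P.indep_var (PiM {i} (\<lambda>_. D)) (\<lambda>\<omega>. restrict (\<lambda>i. \<omega> i) {i})
        (PiM {j} (\<lambda>_. D)) (\<lambda>\<omega>. restrict (\<lambda>i. \<omega> i) {j})"
      by (rule P.indep_var_restrict) (use ij in auto)
    then have "P.indep_var D ((\<lambda>u. u i) \<circ> (\<lambda>\<omega>. restrict (\<lambda>i. \<omega> i) {i}))
        D ((\<lambda>u. u j) \<circ> (\<lambda>\<omega>. restrict (\<lambda>i. \<omega> i) {j}))"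
      by (rule P.indep_var_compose) auto
    then have "distr ?P D (\<lambda>w. w i) \<Otimes>\<^sub>M distr ?P D (\<lambda>w. w j) = distr ?P (D \<Otimes>\<^sub>M D) (\<lambda>w. (w i, w j))"
      by (simp add: P.indep_var_distribution_eq comp_def)
    moreover have "distr ?P D (\<lambda>w. w l) = D" if "l < m" for l
    proof -
      interpret product_prob_space "\<lambda>_. D" "{..<m}" ..
      show ?thesis using that by (intro PiM_component) simp
    qed
    ultimately have law: "distr ?P (D \<Otimes>\<^sub>M D) (\<lambda>w. (w i, w j)) = D \<Otimes>\<^sub>M D" using ij by simp
    have "AE z in distr ?P (D \<Otimes>\<^sub>M D) (\<lambda>w. (w i, w j)). fst z \<noteq> snd z"
      unfolding law by (rule DD_ne)
    from AE_distrD[OF _ this] show ?thesis using ij by simp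
  qed
  then have "AE w in ?P. \<forall>i\<in>{..<m}. \<forall>j\<in>{..<m}. i \<noteq> j \<longrightarrow> w i \<noteq> w j"
    by (intro AE_finite_allI AE_impI) auto
  then show ?thesis by (auto simp: inj_on_def elim!: eventually_mono)
qed

lemma measurable_block_max:
  assumes "0 < k"
  shows "block_max n k \<in> PiM {..<n * k} (\<lambda>_. borel) \<rightarrow>\<^sub>M PiM {..<n} (\<lambda>_. borel)"
  unfolding block_max_def
proof (rule measurable_restrict)
  fix i assume "i \<in> {..<n}"
  then show "(\<lambda>w. Max ((\<lambda>l. w (i * k + l) :: real) ` {..<k})) \<in> borel_measurable (PiM {..<n * k} (\<lambda>_. borel))"
    by (intro borel_measurable_Max) (auto intro!: measurable_component_singleton block_index_less)
qed

text \<open>The maximum of a block of \<open>k\<close> independent draws from \<open>H\<close> has cdf \<open>(cdf H)^k\<close>, and disjoint blocks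
  are independent.\<close>
lemma distr_block_max:
  assumes H: "is_prior H" and F: "is_prior F" and k: "0 < k" and n: "0 < n"
    and cdf: "\<And>x. cdf H x = cdf F x powr (1 / real k)"
  shows "distr (PiM {..<n * k} (\<lambda>_. H)) (PiM {..<n} (\<lambda>_. borel)) (block_max n k)
           = PiM {..<n} (\<lambda>_. F)"
proof -
  let ?P = "PiM {..<n * k} (\<lambda>_. H)"
  let ?K = "\<lambda>i. {i * k..<i * k + k}"
  let ?Y = "\<lambda>i u. Max ((\<lambda>l. u (i * k + l)) ` {..<k})"
  note Hp = is_priorD[OF H]
  note [measurable_cong] = Hp(2)
  interpret product_prob_space "\<lambda>_. H" "{..<n * k}"
    using Hp(1) by (simp add: product_prob_space_def product_prob_space_axioms_def product_sigma_finite_def prob_space_imp_sigma_finite)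
  interpret HR: real_distribution H using H by (simp add: is_prior_def)
  interpret FR: real_distribution F using F by (simp add: is_prior_def)
  have Ksub: "?K i \<subseteq> {..<n * k}" if "i < n" for i
  proof -
    have "Suc i * k \<le> n * k" using that by (intro mult_le_mono1) simp
    then show ?thesis by auto
  qed
  have disj: "disjoint_family_on ?K {..<n}"
    unfolding disjoint_family_on_def
  proof (intro ballI impI)
    fix i j :: nat assume "i \<noteq> j"
    then have "Suc i * k \<le> j * k \<or> Suc j * k \<le> i * k" 
      by (cases "i < j") (auto intro!: mult_le_mono1 simp del: mult_Suc)
    then show "?K i \<inter> ?K j = {}" by auto
  qed
  have "0 < n * k" using n k by simp
  then have nk: "{..<n * k} \<noteq> {}" by blast
  have Ym: "?Y i \<in> borel_measurable (PiM (?K i) (\<lambda>_. H))" for i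
    using Hp(2) by (intro borel_measurable_Max) (auto simp: measurable_component_singleton)
  have "P.indep_vars (\<lambda>i. PiM (?K i) (\<lambda>_. H)) (\<lambda>i \<omega>. restrict (\<lambda>p. \<omega> p) (?K i)) {..<n}"
    by (rule P.indep_vars_restrict[OF indep_vars_PiM_coordinates[OF Hp(1) nk] _ disj])
       (use Ksub in auto)
  then have "P.indep_vars (\<lambda>_. borel) (\<lambda>i \<omega>. ?Y i (restrict (\<lambda>p. \<omega> p) (?K i))) {..<n}"
    by (rule P.indep_vars_compose2) (rule Ym)
  also have "(\<lambda>i \<omega>. ?Y i (restrict (\<lambda>p. \<omega> p) (?K i))) = (\<lambda>i \<omega>. ?Y i \<omega>)"
    by (intro ext arg_cong[where f = Max] image_cong) auto
  finally have ind: "P.indep_vars (\<lambda>_. borel) ?Y {..<n}" .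
  have rv: "?Y i \<in> borel_measurable ?P" if "i < n" for i
    using Hp(2) block_index_less[OF that]
    by (intro borel_measurable_Max) (auto simp: measurable_component_singleton)
  have law: "distr ?P borel (?Y i) = F" if i: "i < n" for i
  proof (rule cdf_unique)
    interpret R: prob_space "distr ?P borel (?Y i)" using rv[OF i] by (rule P.prob_space_distr)
    show "real_distribution (distr ?P borel (?Y i))"
      by (simp add: real_distribution_def real_distribution_axioms_def R.prob_space_axioms)
    show "real_distribution F" by unfold_locales
    show "cdf (distr ?P borel (?Y i)) = cdf F"
    proof
      fix a
      have "cdf (distr ?P borel (?Y i)) a = P.prob (?Y i -` {..a} \<inter> space ?P)"
        unfolding cdf_def by (rule measure_distr[OF rv[OF i]]) simp
      also have "?Y i -` {..a} \<inter> space ?P = {w \<in> space ?P. \<forall>p\<in>?K i. w p \<in> {..a}}"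
      proof -
        have "?Y i w \<le> a \<longleftrightarrow> (\<forall>p\<in>?K i. w p \<le> a)" for w
        proof -
          have "?K i = (\<lambda>l. i * k + l) ` {..<k}"
            by (simp add: lessThan_atLeast0 add.commute)
          then show ?thesis using k by (subst Max_le_iff) auto
        qed
        then show ?thesis by auto
      qed
      also have "emeasure ?P \<dots> = (\<Prod>p\<in>?K i. emeasure H {..a})"
        by (rule emeasure_PiM_Collect[OF Ksub[OF i]]) auto
      then have "P.prob {w \<in> space ?P. \<forall>p\<in>?K i. w p \<in> {..a}} = measure H {..a} ^ k"
        using finite_measure.emeasure_eq_measure[OF prob_space.finite_measure[OF Hp(1)]]
        by (simp add: P.emeasure_eq_measure ennreal_power)
      also have "measure H {..a} ^ k = cdf F a"
        using cdf[of a] powr_inverse_nat_eq_root[OF k FR.cdf_nonneg] FR.cdf_nonneg[of a] k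
        by (simp add: cdf_def)
      finally show "cdf (distr ?P borel (?Y i)) a = cdf F a" .
    qed
  qed
  have "distr ?P (PiM {..<n} (\<lambda>_. borel)) (block_max n k)
      = (\<Pi>\<^sub>M i\<in>{..<n}. distr ?P borel (?Y i))"
    unfolding block_max_def
    by (rule P.indep_vars_iff_distr_eq_PiM'[THEN iffD1, OF _ _ ind]) (use n rv in auto)
  also have "\<dots> = PiM {..<n} (\<lambda>_. F)" by (rule PiM_cong) (auto simp: law)
  finally show ?thesis .
qed


section \<open>Positions of the maxima within the blocks\<close>

lemma is_block_argmax_exists:
  assumes "0 < k"
  obtains c where "c \<in> {..<n} \<rightarrow>\<^sub>E {..<k}" "is_block_argmax n k w c"
proof -
  have "\<exists>l<k. \<forall>l'<k. w (i * k + l') \<le> w (i * k + l)" for i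
  proof -
    have "Max ((\<lambda>l. w (i * k + l)) ` {..<k}) \<in> (\<lambda>l. w (i * k + l)) ` {..<k}"
      using assms by (intro Max_in) auto
    then obtain l where "l < k" "w (i * k + l) = Max ((\<lambda>l. w (i * k + l)) ` {..<k})" by auto
    then show ?thesis by (auto intro!: exI[of _ l])
  qed
  then obtain c where "\<And>i. c i < k \<and> (\<forall>l'<k. w (i * k + l') \<le> w (i * k + c i))" by metis
  then show ?thesis
    by (intro that[of "restrict c {..<n}"]) (auto simp: is_block_argmax_def)
qed

lemma is_block_argmax_unique:
  assumes inj: "inj_on w {..<n * k}" and c: "c \<in> {..<n} \<rightarrow>\<^sub>E {..<k}" "is_block_argmax n k w c"
    and d: "d \<in> {..<n} \<rightarrow>\<^sub>E {..<k}" "is_block_argmax n k w d"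
  shows "c = d"
proof (rule PiE_ext[OF c(1) d(1)])
  fix i assume "i \<in> {..<n}"
  then have i: "i < n" "c i < k" "d i < k" using c d by auto
  have "w (i * k + c i) = w (i * k + d i)"
    using c(2) d(2) i unfolding is_block_argmax_def by (meson order.antisym)
  then have "i * k + c i = i * k + d i"
    by (rule inj_onD[OF inj]) (use block_index_less[OF i(1)] i in auto)
  then show "c i = d i" by simp
qed

lemma measurable_is_block_argmax:
  "Measurable.pred (PiM {..<n * k} (\<lambda>_. borel)) (\<lambda>w. is_block_argmax n k w c)"
proof (cases "\<forall>i<n. c i < k")
  case True
  have *: "Measurable.pred (PiM {..<n * k} (\<lambda>_. borel)) (\<lambda>w. w (i * k + l) \<le> (w (i * k + l') :: real))"
    if "i < n" "l < k" "l' < k" for i l l'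
    using block_index_less[OF that(1)] that
    unfolding pred_def by (intro borel_measurable_le measurable_component_singleton) auto
  have "Measurable.pred (PiM {..<n * k} (\<lambda>_. borel))
      (\<lambda>w. \<forall>i\<in>{..<n}. \<forall>l\<in>{..<k}. w (i * k + l) \<le> (w (i * k + c i) :: real))"
    using True by (intro pred_intros_finite *) auto
  also have "(\<lambda>w. \<forall>i\<in>{..<n}. \<forall>l\<in>{..<k}. w (i * k + l) \<le> (w (i * k + c i) :: real)) = (\<lambda>w. is_block_argmax n k w c)"
    using True by (auto simp: is_block_argmax_def fun_eq_iff)
  finally show ?thesis .
next
  case False
  then have "(\<lambda>w. is_block_argmax n k w c) = (\<lambda>_. False)"
    by (auto simp: is_block_argmax_def fun_eq_iff)
  then show ?thesis by simp
qed

text \<open>\<open>p div k\<close> is the block and \<open>p mod k\<close> the offset in it. A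
  transposition is its own inverse, so the map is an involution, which yields bijectivity at
  once.\<close>

definition block_perm :: "nat \<Rightarrow> (nat \<Rightarrow> nat) \<Rightarrow> nat \<Rightarrow> nat" where
  "block_perm k c p = (p div k) * k + Transposition.transpose 0 (c (p div k)) (p mod k)"

lemma nn_integral_PiM_permute:
  fixes D :: "real measure"
  assumes D: "prob_space D" and p: "bij_betw p {..<m::nat} {..<m}"
    and f: "f \<in> borel_measurable (PiM {..<m} (\<lambda>_. D))"
  shows "(\<integral>\<^sup>+w. f (\<lambda>j\<in>{..<m}. w (p j)) \<partial>PiM {..<m} (\<lambda>_. D)) = (\<integral>\<^sup>+w. f w \<partial>PiM {..<m} (\<lambda>_. D))"
proof -
  have p': "inj_on p {..<m}" "p \<in> {..<m} \<rightarrow> {..<m}" using p by (auto simp: bij_betw_def)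
  have "(\<integral>\<^sup>+w. f w \<partial>PiM {..<m} (\<lambda>_. D))
      = (\<integral>\<^sup>+w. f w \<partial>distr (PiM {..<m} (\<lambda>_. D)) (PiM {..<m} (\<lambda>_. D)) (\<lambda>w. \<lambda>j\<in>{..<m}. w (p j)))"
    by (subst distr_PiM_reindex[OF D p']) auto
  also have "\<dots> = (\<integral>\<^sup>+w. f (\<lambda>j\<in>{..<m}. w (p j)) \<partial>PiM {..<m} (\<lambda>_. D))"
    using p' f by (intro nn_integral_distr measurable_restrict measurable_component_singleton) auto
  finally show ?thesis ..
qed

text \<open>Transposing \<open>0\<close> and \<open>c i\<close> inside each block preserves the law and the block maxima and moves
  the position of the maximum from \<open>0\<close> to \<open>c\<close>.\<close>
lemma nn_integral_block_argmax_const: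
  fixes D :: "real measure"
  assumes D: "prob_space D" and sets_D: "sets D = sets borel"
    and c: "c \<in> {..<n} \<rightarrow>\<^sub>E {..<k}"
    and f: "f \<in> borel_measurable (PiM {..<n} (\<lambda>_. borel))"
  shows "(\<integral>\<^sup>+w. indicator {w. is_block_argmax n k w c} w * f (block_max n k w) \<partial>PiM {..<n * k} (\<lambda>_. D))
       = (\<integral>\<^sup>+w. indicator {w. is_block_argmax n k w (\<lambda>_. 0)} w * f (block_max n k w) \<partial>PiM {..<n * k} (\<lambda>_. D))"
proof (cases "n * k = 0")
  \<comment> \<open>Degenerate sizes: with no blocks both conditions are vacuous, and with empty
    blocks there is no \<open>c\<close>.\<close>
  case True
  show ?thesis
  proof (cases "n = 0")
    case True
    then show ?thesis by (simp add: is_block_argmax_def)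
  next
    case False
    then have "k = 0" using True by simp
    then have "c 0 < 0" using c False by auto
    then show ?thesis by simp
  qed
next
  case False
  then have k: "0 < k" and n: "0 < n" by auto
  let ?p = "block_perm k c" and ?P = "PiM {..<n * k} (\<lambda>_. D)"
  have [measurable_cong]: "sets ?P = sets (PiM {..<n * k} (\<lambda>_. borel))"
    using sets_D by (intro sets_PiM_cong) auto
  have tr: "Transposition.transpose 0 (c i) l < k" if "i < n" "l < k" for i l
    using that c k by (auto simp: Transposition.transpose_def)
  have p_block: "?p (i * k + l) = i * k + Transposition.transpose 0 (c i) l" if "l < k" for i l
    using that k by (simp add: block_perm_def)
  have p_less: "?p q < n * k" if "q < n * k" for q
    using that by (elim block_decompose) (simp add: p_block tr block_index_less)
  have p_invol: "?p (?p q) = q" if "q < n * k" for q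
    using that by (elim block_decompose) (simp add: p_block tr)
  have bij: "bij_betw ?p {..<n * k} {..<n * k}"
    by (rule bij_betw_byWitness[of _ ?p]) (use p_less p_invol in auto)
  define g where "g w = (\<lambda>j\<in>{..<n * k}. w (?p j))" for w :: "nat \<Rightarrow> real"
  have g: "g w (i * k + l) = w (i * k + Transposition.transpose 0 (c i) l)" if "i < n" "l < k" for w i l
    using that by (simp add: g_def p_block block_index_less)
  have tr_image: "Transposition.transpose 0 (c i) ` {..<k} = {..<k}" if i: "i < n" for i
  proof (intro equalityI subsetI)
    fix l assume "l \<in> {..<k}"
    then show "l \<in> Transposition.transpose 0 (c i) ` {..<k}"
      using tr[OF i] by (intro image_eqI[of _ _ "Transposition.transpose 0 (c i) l"]) auto
  qed (use tr[OF i] in auto)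
  \<comment> \<open>The permuted sequence \<open>g w\<close> has at offset 0 of block
    \<open>i\<close> the entry that \<open>w\<close> has at offset \<open>c i\<close>, and each
    block keeps its set of entries.\<close>
  have arg: "is_block_argmax n k (g w) (\<lambda>_. 0) \<longleftrightarrow> is_block_argmax n k w c" for w
    unfolding is_block_argmax_def
  proof (intro all_cong)
    fix i assume i: "i < n"
    have g0: "g w (i * k + 0) = w (i * k + c i)" using g[OF i k, of w] by simp
    have "(\<forall>l\<in>{..<k}. g w (i * k + l) \<le> g w (i * k + 0))
        \<longleftrightarrow> (\<forall>l\<in>{..<k}. w (i * k + Transposition.transpose 0 (c i) l) \<le> w (i * k + c i))"
      unfolding g0 using g[OF i, of _ w] by (intro ball_cong) auto
    also have "\<dots> \<longleftrightarrow> (\<forall>l\<in>Transposition.transpose 0 (c i) ` {..<k}. w (i * k + l) \<le> w (i * k + c i))"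
      by blast
    finally have "(\<forall>l<k. g w (i * k + l) \<le> g w (i * k + 0)) \<longleftrightarrow> (\<forall>l<k. w (i * k + l) \<le> w (i * k + c i))"
      unfolding tr_image[OF i] by blast
    moreover have "c i < k" using c i by auto
    ultimately show "(0 < k \<and> (\<forall>l<k. g w (i * k + l) \<le> g w (i * k + 0)))
        = (c i < k \<and> (\<forall>l<k. w (i * k + l) \<le> w (i * k + c i)))" using k by blast
  qed
  have bm: "block_max n k (g w) = block_max n k w" for w
    unfolding block_max_def
  proof (intro restrict_ext arg_cong[where f = Max])
    fix i assume "i \<in> {..<n}"
    then have i: "i < n" by simp
    have "(\<lambda>l. g w (i * k + l)) ` {..<k} = (\<lambda>l. w (i * k + Transposition.transpose 0 (c i) l)) ` {..<k}"
      using g[OF i] by (intro image_cong) auto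
    also have "\<dots> = (\<lambda>l. w (i * k + l)) ` Transposition.transpose 0 (c i) ` {..<k}"
      by (simp only: image_image)
    finally show "(\<lambda>l. g w (i * k + l)) ` {..<k} = (\<lambda>l. w (i * k + l)) ` {..<k}"
      unfolding tr_image[OF i] .
  qed
  have [measurable]: "block_max n k \<in> ?P \<rightarrow>\<^sub>M PiM {..<n} (\<lambda>_. borel)"
    using measurable_block_max[OF k, of n] by (simp cong: measurable_cong_sets)
  have [measurable]: "Measurable.pred ?P (\<lambda>w. is_block_argmax n k w c)" for c
    using measurable_is_block_argmax[of n k c] by (simp cong: measurable_cong_sets)
  note [measurable] = f
  have m: "(\<lambda>w. indicator {w. is_block_argmax n k w (\<lambda>_. 0)} w * f (block_max n k w)) \<in> borel_measurable ?P"
    by measurable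
  show ?thesis
    using nn_integral_PiM_permute[OF D bij m] unfolding g_def[symmetric] bm
    by (simp add: indicator_def arg)
qed

text \<open>Conditioned on the positions being \<open>c\<close>, an event of probability
  \<open>k^(-n)\<close>, the block maxima still have law \<open>F\<close>: almost surely exactly one
  of the \<open>k^n\<close> position vectors fits, and by symmetry all of them contribute
  equally.\<close>

lemma nn_integral_block_argmax:
  assumes H: "is_prior H" and F: "is_prior F" and k: "0 < k" and n: "0 < n"
    and cdf: "\<And>x. cdf H x = cdf F x powr (1 / real k)"
    and c: "c \<in> {..<n} \<rightarrow>\<^sub>E {..<k}"
    and f: "f \<in> borel_measurable (PiM {..<n} (\<lambda>_. borel))"
  shows "(\<integral>\<^sup>+y. f y \<partial>PiM {..<n} (\<lambda>_. F)) = of_nat (k ^ n) *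
    (\<integral>\<^sup>+w. indicator {w. is_block_argmax n k w c} w * f (block_max n k w) \<partial>PiM {..<n * k} (\<lambda>_. H))"
proof -
  let ?P = "PiM {..<n * k} (\<lambda>_. H)" and ?C = "{..<n} \<rightarrow>\<^sub>E {..<k}"
  let ?I = "\<lambda>c w. indicator {w. is_block_argmax n k w c} w * f (block_max n k w)"
  note Hp = is_priorD[OF H]
  have [measurable_cong]: "sets ?P = sets (PiM {..<n * k} (\<lambda>_. borel))"
    using Hp(2) by (intro sets_PiM_cong) auto
  have [measurable]: "block_max n k \<in> ?P \<rightarrow>\<^sub>M PiM {..<n} (\<lambda>_. borel)"
    using measurable_block_max[OF k, of n] by (simp cong: measurable_cong_sets)
  have [measurable]: "Measurable.pred ?P (\<lambda>w. is_block_argmax n k w c)" for c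
    using measurable_is_block_argmax[of n k c] by (simp cong: measurable_cong_sets)
  note [measurable] = f
  have fin: "finite ?C" by (intro finite_PiE) auto
  have "(\<integral>\<^sup>+y. f y \<partial>PiM {..<n} (\<lambda>_. F)) = (\<integral>\<^sup>+w. f (block_max n k w) \<partial>?P)"
    by (subst distr_block_max[OF H F k n cdf, symmetric]) (rule nn_integral_distr; measurable)
  also have "\<dots> = (\<integral>\<^sup>+w. (\<Sum>d\<in>?C. ?I d w) \<partial>?P)"
  proof (rule nn_integral_cong_AE)
    show "AE w in ?P. f (block_max n k w) = (\<Sum>d\<in>?C. ?I d w)"
      using AE_PiM_inj_on[OF Hp, of "n * k"]
    proof eventually_elim
      case (elim w)
      obtain e where e: "e \<in> ?C" "is_block_argmax n k w e"
        using is_block_argmax_exists[OF k] by blast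
      have uniq: "\<not> is_block_argmax n k w d" if "d \<in> ?C - {e}" for d
        using is_block_argmax_unique[OF elim _ _ e, of d] that by blast
      have "(\<Sum>d\<in>?C. ?I d w) = (\<Sum>d\<in>{e}. ?I d w)"
        by (intro sum.mono_neutral_right[OF fin]) (use e uniq in auto)
      then show ?case using e by simp
    qed
  qed
  also have "\<dots> = (\<Sum>d\<in>?C. \<integral>\<^sup>+w. ?I d w \<partial>?P)"
    by (rule nn_integral_sum) measurable
  also have "\<dots> = (\<Sum>d\<in>?C. \<integral>\<^sup>+w. ?I c w \<partial>?P)"
    using nn_integral_block_argmax_const[OF Hp(1,2) _ f] c by (intro sum.cong) auto
  finally show ?thesis by (simp add: card_PiE)
qed

text \<open>The space is finite and each of its points is a measurable box of mass
  \<open>k^(-n)\<close>, so an arbitrary \<open>f\<close> is a finite combination of indicators and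
  integrates to its average.\<close>

lemma nn_integral_PiM_uniform_count:
  assumes k: "0 < k"
  shows "(\<integral>\<^sup>+c. f c \<partial>PiM {..<n} (\<lambda>_. uniform_count_measure {..<k}))
    = (\<Sum>c\<in>{..<n} \<rightarrow>\<^sub>E {..<k}. f c * ennreal (1 / real (k ^ n)))"
proof -
  let ?U = "uniform_count_measure {..<k}" and ?C = "{..<n} \<rightarrow>\<^sub>E {..<k}"
  let ?P = "PiM {..<n} (\<lambda>_. ?U)"
  have U: "prob_space ?U" using k by (intro prob_space_uniform_count_measure) auto
  interpret product_prob_space "\<lambda>_. ?U" "{..<n}"
    using U by (simp add: product_prob_space_def product_prob_space_axioms_def product_sigma_finite_def prob_space_imp_sigma_finite)
  have fin: "finite ?C" by (intro finite_PiE) auto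
  have space: "space ?P = ?C" by (simp add: space_PiM space_uniform_count_measure)
  have sing: "{c} = Pi\<^sub>E {..<n} (\<lambda>i. {c i})" if "c \<in> ?C" for c
    using that by (intro PiE_singleton[symmetric]) (auto simp: PiE_def)
  have m: "{c} \<in> sets ?P" if "c \<in> ?C" for c
    unfolding sing[OF that] using that by (intro sets_PiM_I_finite) (auto simp: sets_uniform_count_measure)
  have em: "emeasure ?P {c} = ennreal (1 / real (k ^ n))" if c: "c \<in> ?C" for c
  proof -
    have "emeasure ?P {c} = (\<Prod>i<n. emeasure ?U {c i})"
      unfolding sing[OF c] using c by (intro emeasure_PiM) (auto simp: sets_uniform_count_measure)
    also have "\<dots> = (\<Prod>i<n. ennreal (1 / real k))"
    proof (rule prod.cong[OF refl])
      fix i assume "i \<in> {..<n}"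
      then have "c i < k" using c by auto
      then show "emeasure ?U {c i} = ennreal (1 / real k)"
        by (simp add: emeasure_uniform_count_measure)
    qed
    finally show ?thesis by (simp add: ennreal_power power_divide)
  qed
  have "(\<integral>\<^sup>+c. f c \<partial>?P) = (\<integral>\<^sup>+c. (\<Sum>d\<in>?C. f d * indicator {d} c) \<partial>?P)"
  proof (rule nn_integral_cong)
    fix c assume "c \<in> space ?P"
    then have "c \<in> ?C" by (simp add: space)
    moreover have "f d * indicator {d} c = 0" if "d \<in> ?C - {c}" for d
      using that by (simp add: indicator_def) blast
    ultimately have "(\<Sum>d\<in>?C. f d * indicator {d} c) = (\<Sum>d\<in>{c}. f d * indicator {d} c)"
      by (intro sum.mono_neutral_right[OF fin]) simp_all
    then show "f c = (\<Sum>d\<in>?C. f d * indicator {d} c)" by simp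
  qed
  also have "\<dots> = (\<Sum>d\<in>?C. \<integral>\<^sup>+c. f d * indicator {d} c \<partial>?P)"
    using m by (intro nn_integral_sum borel_measurable_times_ennreal) auto
  also have "\<dots> = (\<Sum>d\<in>?C. f d * ennreal (1 / real (k ^ n)))"
    using m em by (intro sum.cong refl) (simp add: nn_integral_cmult_indicator)
  finally show ?thesis .
qed

text \<open>The coupling in integrated form. The bound \<open>le\<close> is asked only at the true
  positions \<open>c\<close> of the maxima of \<open>w\<close>; since these are uniform and
  independent of the maxima, they may be replaced by the internal randomness of the reduced
  algorithm, drawn separately from the values.\<close>

lemma nn_integral_block_coupling:
  assumes H: "is_prior H" and F: "is_prior F" and k: "0 < k" and n: "0 < n"
    and cdf: "\<And>x. cdf H x = cdf F x powr (1 / real k)"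
    and f: "\<And>c. c \<in> {..<n} \<rightarrow>\<^sub>E {..<k} \<Longrightarrow> f c \<in> borel_measurable (PiM {..<n} (\<lambda>_. borel))"
    and le: "\<And>c w. c \<in> {..<n} \<rightarrow>\<^sub>E {..<k} \<Longrightarrow> inj_on w {..<n * k} \<Longrightarrow> is_block_argmax n k w c
      \<Longrightarrow> h w \<le> f c (block_max n k w)"
  shows "(\<integral>\<^sup>+w. h w \<partial>PiM {..<n * k} (\<lambda>_. H)) \<le>
    (\<integral>\<^sup>+c. (\<integral>\<^sup>+y. f c y \<partial>PiM {..<n} (\<lambda>_. F)) \<partial>PiM {..<n} (\<lambda>_. uniform_count_measure {..<k}))"
proof -
  let ?P = "PiM {..<n * k} (\<lambda>_. H)" and ?C = "{..<n} \<rightarrow>\<^sub>E {..<k}"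
  let ?I = "\<lambda>c w. indicator {w. is_block_argmax n k w c} w * f c (block_max n k w)"
  note Hp = is_priorD[OF H]
  have [measurable_cong]: "sets ?P = sets (PiM {..<n * k} (\<lambda>_. borel))"
    using Hp(2) by (intro sets_PiM_cong) auto
  have [measurable]: "block_max n k \<in> ?P \<rightarrow>\<^sub>M PiM {..<n} (\<lambda>_. borel)"
    using measurable_block_max[OF k, of n] by (simp cong: measurable_cong_sets)
  have [measurable]: "Measurable.pred ?P (\<lambda>w. is_block_argmax n k w c)" for c
    using measurable_is_block_argmax[of n k c] by (simp cong: measurable_cong_sets)
  have fin: "finite ?C" by (intro finite_PiE) auto
  have "(\<integral>\<^sup>+w. h w \<partial>?P) \<le> (\<integral>\<^sup>+w. (\<Sum>c\<in>?C. ?I c w) \<partial>?P)"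
  proof (rule nn_integral_mono_AE)
    show "AE w in ?P. h w \<le> (\<Sum>c\<in>?C. ?I c w)"
      using AE_PiM_inj_on[OF Hp, of "n * k"]
    proof eventually_elim
      case (elim w)
      obtain e where e: "e \<in> ?C" "is_block_argmax n k w e"
        using is_block_argmax_exists[OF k] by blast
      have "h w \<le> ?I e w" using le[OF e(1) elim e(2)] e by simp
      also have "\<dots> \<le> (\<Sum>c\<in>?C. ?I c w)" by (rule member_le_sum[OF e(1) _ fin]) simp
      finally show ?case .
    qed
  qed
  also have "\<dots> = (\<Sum>c\<in>?C. \<integral>\<^sup>+w. ?I c w \<partial>?P)"
  proof (rule nn_integral_sum)
    fix c assume "c \<in> ?C"
    note [measurable] = f[OF this]
    show "?I c \<in> borel_measurable ?P" by measurable
  qed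
  also have "\<dots> = (\<Sum>c\<in>?C. (\<integral>\<^sup>+y. f c y \<partial>PiM {..<n} (\<lambda>_. F)) * ennreal (1 / real (k ^ n)))"
  proof (rule sum.cong[OF refl])
    fix c assume c: "c \<in> ?C"
    let ?J = "\<integral>\<^sup>+w. ?I c w \<partial>?P"
    have "(of_nat (k ^ n) :: ennreal) * ennreal (1 / real (k ^ n)) = 1"
      using k by (simp add: ennreal_of_nat_eq_real_of_nat ennreal_mult[symmetric] del: of_nat_power)
    moreover have "of_nat (k ^ n) * ?J * ennreal (1 / real (k ^ n)) = ?J * (of_nat (k ^ n) * ennreal (1 / real (k ^ n)))"
      by (simp only: ac_simps)
    ultimately show "?J = (\<integral>\<^sup>+y. f c y \<partial>PiM {..<n} (\<lambda>_. F)) * ennreal (1 / real (k ^ n))"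
      unfolding nn_integral_block_argmax[OF H F k n cdf c f[OF c]] by (simp only: mult_1_right)
  qed
  also have "\<dots> = (\<integral>\<^sup>+c. (\<integral>\<^sup>+y. f c y \<partial>PiM {..<n} (\<lambda>_. F)) \<partial>PiM {..<n} (\<lambda>_. uniform_count_measure {..<k}))"
    by (rule nn_integral_PiM_uniform_count[OF k, symmetric])
  finally show ?thesis .
qed


section \<open>Measurability\<close>

text \<open>The extra index \<open>m\<close> always contributes 0. This turns a maximum over a
  varying subset, with default 0, into one over the fixed set \<open>{..m}\<close>, where
  measurability of finite maxima applies.\<close>

lemma image_if_zero_atMost:
  "(\<lambda>i. if i < m \<and> P i then x i else 0) ` {..m::nat} = insert (0::real) (x ` {i. i < m \<and> P i})"
proof (intro set_eqI iffI)
  fix v assume "v \<in> insert 0 (x ` {i. i < m \<and> P i})"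
  then consider "v = 0" | i where "v = x i" "i < m" "P i" by auto
  then show "v \<in> (\<lambda>i. if i < m \<and> P i then x i else 0) ` {..m}"
  proof cases
    case 1
    then show ?thesis by (intro image_eqI[of _ _ m]) auto
  next
    case (2 i)
    then show ?thesis by (intro image_eqI[of _ _ i]) auto
  qed
qed (auto split: if_splits)

text \<open>Including 0 is harmless: it is the value for no acceptance, and eligible values are
  nonnegative because prefix maxima start from 0.\<close>

lemma accepted_value_eq_Max:
  assumes "\<And>i. i < m \<Longrightarrow> e i \<Longrightarrow> 0 \<le> x i"
  shows "accepted_value m x t e
    = Max ((\<lambda>i. if i < m \<and> e i \<and> \<not> (\<exists>j<m. e j \<and> t j < t i) then x i else 0) ` {..m})"
proof -
  let ?A = "{i. i < m \<and> e i \<and> \<not> (\<exists>j<m. e j \<and> t j < t i)}"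
  have fin: "finite ?A" by auto
  show ?thesis
  proof (cases "?A = {}")
    case True
    then show ?thesis unfolding image_if_zero_atMost accepted_value_def Let_def by (simp only: True) simp
  next
    case False
    have "0 \<le> Max (x ` ?A)"
      using False assms fin by (subst Max_ge_iff) auto
    then have "Max (insert 0 (x ` ?A)) = Max (x ` ?A)"
      using False fin by (subst Max_insert) auto
    then show ?thesis
      unfolding image_if_zero_atMost accepted_value_def Let_def by (simp only: False if_False)
  qed
qed

lemma measurable_accepted_value:
  assumes x: "\<And>j. j < m \<Longrightarrow> (\<lambda>\<omega>. x \<omega> j) \<in> borel_measurable N"
    and t: "\<And>j. j < m \<Longrightarrow> (\<lambda>\<omega>. t \<omega> j) \<in> borel_measurable N"
    and e: "\<And>j. j < m \<Longrightarrow> Measurable.pred N (\<lambda>\<omega>. e \<omega> j)"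
    and nonneg: "\<And>j \<omega>. j < m \<Longrightarrow> e \<omega> j \<Longrightarrow> 0 \<le> x \<omega> j"
  shows "(\<lambda>\<omega>. accepted_value m (x \<omega>) (t \<omega>) (e \<omega>)) \<in> borel_measurable N"
proof -
  have acc: "Measurable.pred N (\<lambda>\<omega>. i < m \<and> e \<omega> i \<and> \<not> (\<exists>j\<in>{..<m}. e \<omega> j \<and> t \<omega> j < t \<omega> i))" for i
  proof (cases "i < m")
    case True
    have ex: "Measurable.pred N (\<lambda>\<omega>. \<exists>j\<in>{..<m}. e \<omega> j \<and> t \<omega> j < t \<omega> i)"
      using True
      by (intro pred_intros_finite(4) finite_lessThan pred_intros_logic(3) e borel_measurable_pred_less t) auto
    show ?thesis by (intro pred_intros_logic(2,3) e[OF True] ex) simp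
  qed simp
  have "(\<lambda>\<omega>. if i < m \<and> e \<omega> i \<and> \<not> (\<exists>j\<in>{..<m}. e \<omega> j \<and> t \<omega> j < t \<omega> i) then x \<omega> i else 0) \<in> borel_measurable N" for i
  proof (cases "i < m")
    case True
    show ?thesis
      by (rule measurable_If[OF x[OF True] borel_measurable_const acc[of i, unfolded pred_def]])
  qed simp
  then have "(\<lambda>\<omega>. Max ((\<lambda>i. if i < m \<and> e \<omega> i \<and> \<not> (\<exists>j\<in>{..<m}. e \<omega> j \<and> t \<omega> j < t \<omega> i) then x \<omega> i else 0) ` {..m}))
      \<in> borel_measurable N"
    by (rule borel_measurable_Max[OF finite_atMost])
  moreover have "accepted_value m (x \<omega>) (t \<omega>) (e \<omega>)
      = Max ((\<lambda>i. if i < m \<and> e \<omega> i \<and> \<not> (\<exists>j\<in>{..<m}. e \<omega> j \<and> t \<omega> j < t \<omega> i) then x \<omega> i else 0) ` {..m})" for \<omega>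
    using accepted_value_eq_Max[of m "e \<omega>" "x \<omega>" "t \<omega>", OF nonneg] unfolding Bex_def lessThan_iff by blast
  ultimately show ?thesis by (simp only:)
qed

lemma measurable_opt_value:
  assumes x: "\<And>j. j < m \<Longrightarrow> (\<lambda>\<omega>. x \<omega> j) \<in> borel_measurable N"
  shows "(\<lambda>\<omega>. opt_value m (x \<omega>)) \<in> borel_measurable N"
proof -
  have "opt_value m y = Max ((\<lambda>i. if i < m then y i else 0) ` {..m})" for y
  proof -
    have "(\<lambda>i. if i < m then y i else 0) ` {..m} = insert 0 (y ` {..<m})"
      using image_if_zero_atMost[of m "\<lambda>_. True" y] by (simp add: lessThan_def)
    then show ?thesis by (simp add: opt_value_def)
  qed
  moreover have "(\<lambda>\<omega>. if i < m then x \<omega> i else 0) \<in> borel_measurable N" for i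
    using x by (cases "i < m") auto
  then have "(\<lambda>\<omega>. Max ((\<lambda>i. if i < m then x \<omega> i else 0) ` {..m})) \<in> borel_measurable N"
    by (intro borel_measurable_Max) auto
  ultimately show ?thesis by simp
qed

lemma measurable_best_so_far:
  assumes x: "\<And>j. j < m \<Longrightarrow> (\<lambda>\<omega>. x \<omega> j) \<in> borel_measurable N"
    and t: "\<And>j. j < m \<Longrightarrow> (\<lambda>\<omega>. t \<omega> j) \<in> borel_measurable N" and i: "i < m"
  shows "Measurable.pred N (\<lambda>\<omega>. best_so_far m (x \<omega>) (t \<omega>) i)"
proof -
  have "Measurable.pred N (\<lambda>\<omega>. 0 \<le> x \<omega> i \<and> (\<forall>j\<in>{..<m}. t \<omega> j < t \<omega> i \<longrightarrow> x \<omega> j \<le> x \<omega> i))"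
    using borel_measurable_le[of _ N] x t i
    by (intro pred_intros_finite(3) finite_lessThan pred_intros_logic(3,4) borel_measurable_pred_less)
       (auto simp: pred_def)
  then show ?thesis by (simp add: best_so_far_iff Ball_def)
qed

lemma measurable_card_less:
  fixes m :: nat
  assumes "\<And>j. j < m \<Longrightarrow> Measurable.pred N (\<lambda>\<omega>. P \<omega> j)"
  shows "(\<lambda>\<omega>. real (card {j. j < m \<and> P \<omega> j})) \<in> borel_measurable N"
proof -
  have "real (card {j. j < m \<and> P \<omega> j}) = (\<Sum>j<m. if P \<omega> j then 1 else 0)" for \<omega>
  proof -
    have "{j. j < m \<and> P \<omega> j} = {..<m} \<inter> {j. P \<omega> j}" by auto
    then show ?thesis by (simp add: sum.If_cases)
  qed
  moreover have "(\<lambda>\<omega>. \<Sum>j<m. if P \<omega> j then 1 else (0::real)) \<in> borel_measurable N"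
    using assms by (intro borel_measurable_sum measurable_If) (auto simp: pred_def)
  ultimately show ?thesis by simp
qed

text \<open>The entry at index \<open>l\<close> of the sorted list is at most \<open>a\<close>
  exactly when more than \<open>l\<close> of the entries are, and this is a measurable
  count.\<close>

lemma measurable_sort_nth:
  assumes l: "l < m"
  shows "(\<lambda>t. sort (map t [0..<m]) ! l :: real) \<in> borel_measurable (PiM {..<m} (\<lambda>_. borel))"
  unfolding borel_measurable_iff_le
proof
  fix a :: real
  let ?P = "PiM {..<m} (\<lambda>_. borel) :: (nat \<Rightarrow> real) measure"
  have "Measurable.pred ?P (\<lambda>t. t j \<le> a)" if "j < m" for j
    unfolding pred_def using that by (intro borel_measurable_le measurable_component_singleton) auto
  then have [measurable]: "(\<lambda>t. real (card {j. j < m \<and> t j \<le> a})) \<in> borel_measurable ?P"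
    by (rule measurable_card_less)
  have "sort (map t [0..<m]) ! l \<le> a \<longleftrightarrow> real l < real (card {j. j < m \<and> t j \<le> a})" for t
    using sort_nth_iff[of l "map t [0..<m]" "\<lambda>v. v \<le> a"] l by (simp only: length_filter_map_upt) auto
  then show "{t \<in> space ?P. sort (map t [0..<m]) ! l \<le> a} \<in> sets ?P" by simp
qed

lemma measurable_arrival_rank_eq:
  assumes t: "\<And>j. j < m \<Longrightarrow> (\<lambda>\<omega>. t \<omega> j) \<in> borel_measurable N" and i: "i < m"
  shows "Measurable.pred N (\<lambda>\<omega>. arrival_rank m (t \<omega>) i = r)"
proof -
  have "Measurable.pred N (\<lambda>\<omega>. t \<omega> j < t \<omega> i)" if "j < m" for j
    using t[OF that] t[OF i] by measurable
  then have [measurable]: "(\<lambda>\<omega>. real (arrival_rank m (t \<omega>) i)) \<in> borel_measurable N"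
    unfolding arrival_rank_def by (rule measurable_card_less)
  have "Measurable.pred N (\<lambda>\<omega>. real (arrival_rank m (t \<omega>) i) = real r)" by measurable
  then show ?thesis by simp
qed

lemma borel_measurable_cdf:
  assumes "is_prior G"
  shows "cdf G \<in> borel_measurable borel"
proof -
  interpret real_distribution G using assms by (simp add: is_prior_def)
  show ?thesis by (intro borel_measurable_mono monoI cdf_nondecreasing)
qed

lemma sets_instance_space:
  assumes "sets F = sets borel"
  shows "sets (instance_space m F) = sets (PiM {..<m} (\<lambda>_. borel :: real measure) \<Otimes>\<^sub>M PiM {..<m} (\<lambda>_. borel :: real measure))"
  unfolding instance_space_def
  by (intro sets_pair_measure_cong sets_PiM_cong) (auto simp: assms sets_unif01)

lemma sets_red_space:
  assumes "sets F = sets borel"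
  shows "sets (red_space n k F) = sets ((PiM {..<n} (\<lambda>_. borel :: real measure) \<Otimes>\<^sub>M PiM {..<n} (\<lambda>_. borel :: real measure))
    \<Otimes>\<^sub>M (PiM {..<n * k} (\<lambda>_. borel :: real measure) \<Otimes>\<^sub>M PiM {..<n} (\<lambda>_. count_space {..<k})))"
  unfolding red_space_def
  by (intro sets_pair_measure_cong sets_PiM_cong sets_instance_space assms)
     (auto simp: sets_unif01 sets_uniform_count_measure_count_space)

lemma measurable_bicrit:
  assumes F: "sets F = sets borel" and G: "is_prior G" and \<theta>: "\<theta> \<in> borel_measurable borel"
  shows "(\<lambda>\<omega>. accepted_value m (fst \<omega>) (snd \<omega>) (bicrit_elig m G \<theta> (fst \<omega>) (snd \<omega>)))
      \<in> borel_measurable (instance_space m F)"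
    and "(\<lambda>\<omega>. opt_value m (fst \<omega>)) \<in> borel_measurable (instance_space m F)"
proof -
  note [measurable_cong] = sets_instance_space[OF F, of m]
  have x: "(\<lambda>\<omega>. fst \<omega> j) \<in> borel_measurable (instance_space m F)" if "j < m" for j
  proof -
    have "j \<in> {..<m}" using that by simp
    then show ?thesis by measurable
  qed
  have t: "(\<lambda>\<omega>. snd \<omega> j) \<in> borel_measurable (instance_space m F)" if "j < m" for j
  proof -
    have "j \<in> {..<m}" using that by simp
    then show ?thesis by measurable
  qed
  show "(\<lambda>\<omega>. opt_value m (fst \<omega>)) \<in> borel_measurable (instance_space m F)"
    by (rule measurable_opt_value) (rule x)
  show "(\<lambda>\<omega>. accepted_value m (fst \<omega>) (snd \<omega>) (bicrit_elig m G \<theta> (fst \<omega>) (snd \<omega>)))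
      \<in> borel_measurable (instance_space m F)"
  proof (rule measurable_accepted_value[OF x t])
    fix j assume j: "j < m"
    have "(\<lambda>\<omega>. \<theta> (snd \<omega> j)) \<in> borel_measurable (instance_space m F)"
      "(\<lambda>\<omega>. cdf G (fst \<omega> j)) \<in> borel_measurable (instance_space m F)"
      by (rule measurable_compose[OF t[OF j] \<theta>], rule measurable_compose[OF x[OF j] borel_measurable_cdf[OF G]])
    then show "Measurable.pred (instance_space m F) (\<lambda>\<omega>. bicrit_elig m G \<theta> (fst \<omega>) (snd \<omega>) j)"
      unfolding bicrit_elig_def by (intro pred_intros_logic(3) measurable_best_so_far[OF x t j] borel_measurable_pred_less)
  qed (auto simp: bicrit_elig_def best_so_far_iff)
qed

lemma measurable_red:
  fixes n k :: nat
  assumes F: "sets F = sets borel" and G: "is_prior G" and \<theta>: "\<theta> \<in> borel_measurable borel"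
  defines "A \<equiv> \<lambda>\<omega>. accepted_value n (fst (fst \<omega>)) (snd (fst \<omega>))
        (red_elig n k G \<theta> (fst (fst \<omega>)) (snd (fst \<omega>)) (fst (snd \<omega>)) (snd (snd \<omega>)))"
  shows "A \<in> borel_measurable (red_space n k F)"
    and "(\<lambda>\<omega>. opt_value n (fst (fst \<omega>))) \<in> borel_measurable (red_space n k F)"
proof -
  let ?R = "red_space n k F"
  note [measurable_cong] = sets_red_space[OF F, of n k]
  have space: "snd (snd \<omega>) r < k" if "\<omega> \<in> space ?R" "r < n" for \<omega> r
    using that by (auto simp: red_space_def space_pair_measure space_PiM space_uniform_count_measure)
  have x: "(\<lambda>\<omega>. fst (fst \<omega>) j) \<in> borel_measurable ?R" if "j < n" for j
  proof -
    have "j \<in> {..<n}" using that by simp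
    then show ?thesis by measurable
  qed
  have t: "(\<lambda>\<omega>. snd (fst \<omega>) j) \<in> borel_measurable ?R" if "j < n" for j
  proof -
    have "j \<in> {..<n}" using that by simp
    then show ?thesis by measurable
  qed
  show "(\<lambda>\<omega>. opt_value n (fst (fst \<omega>))) \<in> borel_measurable ?R"
    by (rule measurable_opt_value) (rule x)
  show "A \<in> borel_measurable ?R"
    unfolding A_def
  proof (rule measurable_accepted_value[OF x t])
    fix j assume j: "j < n"
    \<comment> \<open>The index into the sorted times is itself random; splitting by the finitely
      many ranks \<open>r\<close> and offsets \<open>l\<close> leaves a fixed order statistic in
      each case.\<close>
    let ?Q = "\<lambda>\<omega> r l. arrival_rank n (snd (fst \<omega>)) j = r \<and> snd (snd \<omega>) r = l \<and>
        \<theta> (sort (map (fst (snd \<omega>)) [0..<n*k]) ! (r * k + l)) < cdf G (fst (fst \<omega>) j) powr (1 / real k)"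
    have p: "(\<lambda>\<omega>. cdf G (fst (fst \<omega>) j) powr (1 / real k)) \<in> borel_measurable ?R"
      by (intro powr_real_measurable borel_measurable_const measurable_compose[OF x[OF j] borel_measurable_cdf[OF G]])
    have t': "(\<lambda>\<omega>. fst (snd \<omega>)) \<in> ?R \<rightarrow>\<^sub>M PiM {..<n * k} (\<lambda>_. borel)"
      by measurable
    have "Measurable.pred ?R (\<lambda>\<omega>. \<exists>r\<in>{..<n}. \<exists>l\<in>{..<k}. ?Q \<omega> r l)"
    proof (intro pred_intros_finite finite_lessThan)
      fix r l assume rl: "r \<in> {..<n}" "l \<in> {..<k}"
      have c: "(\<lambda>\<omega>. snd (snd \<omega>) r) \<in> ?R \<rightarrow>\<^sub>M count_space {..<k}"
        using rl(1) by measurable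
      have s: "(\<lambda>\<omega>. \<theta> (sort (map (fst (snd \<omega>)) [0..<n*k]) ! (r * k + l))) \<in> borel_measurable ?R"
        using rl by (intro measurable_compose[OF measurable_compose[OF t' measurable_sort_nth] \<theta>] block_index_less) auto
      show "Measurable.pred ?R (\<lambda>\<omega>. ?Q \<omega> r l)"
        using rl measurable_compose[OF c, of "\<lambda>v. v = l" "count_space UNIV"]
        by (intro pred_intros_logic(3) measurable_arrival_rank_eq[OF t j] borel_measurable_pred_less[OF s p]) auto
    qed
    then have "Measurable.pred ?R (\<lambda>\<omega>. best_so_far n (fst (fst \<omega>)) (snd (fst \<omega>)) j \<and>
        (\<exists>r\<in>{..<n}. \<exists>l\<in>{..<k}. ?Q \<omega> r l))"
      by (intro pred_intros_logic(3) measurable_best_so_far[OF x t j])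
    then show "Measurable.pred ?R (\<lambda>\<omega>. red_elig n k G \<theta> (fst (fst \<omega>)) (snd (fst \<omega>)) (fst (snd \<omega>)) (snd (snd \<omega>)) j)"
      by (rule measurable_cong[THEN iffD1, rotated])
         (use space arrival_rank_less[OF j] in \<open>auto simp: red_elig_def red_time_def\<close>)
  qed (auto simp: red_elig_def best_so_far_iff)
qed

lemma measurable_seq_value:
  assumes Q: "\<And>l. l < m \<Longrightarrow> Measurable.pred borel (\<lambda>v. Q v l)"
  shows "(\<lambda>w. seq_value m w Q) \<in> borel_measurable (PiM {..<m} (\<lambda>_. borel))"
    and "opt_value m \<in> borel_measurable (PiM {..<m} (\<lambda>_. borel))"
proof -
  let ?P = "PiM {..<m} (\<lambda>_. borel) :: (nat \<Rightarrow> real) measure"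
  have x: "(\<lambda>w. w j) \<in> borel_measurable ?P" if "j < m" for j
    using that by (intro measurable_component_singleton) auto
  show "opt_value m \<in> borel_measurable ?P"
    by (rule measurable_opt_value) (rule x)
  show "(\<lambda>w. seq_value m w Q) \<in> borel_measurable ?P"
    unfolding seq_value_def
  proof (rule measurable_accepted_value[OF x])
    fix j assume j: "j < m"
    note [measurable] = x[OF j] Q[OF j] measurable_best_so_far[OF x _ j, where t = "\<lambda>_. real"]
    show "Measurable.pred ?P (\<lambda>w. best_so_far m w real j \<and> Q (w j) j)" by measurable
  qed (auto simp: best_so_far_iff)
qed

text \<open>With the times held fixed, sorting by arrival is one fixed permutation of independent,
  identically distributed coordinates, so it preserves their law; it also preserves their maximum.
  The payoff \<open>g\<close> takes the accepted value and the optimum, which accommodates both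
  objectives.\<close>

lemma nn_integral_arrival_order:
  assumes F: "is_prior F" and inj: "inj_on t {..<m}"
    and Q: "\<And>l. l < m \<Longrightarrow> Measurable.pred borel (\<lambda>v. Q v l)"
    and g: "case_prod g \<in> borel_measurable (borel \<Otimes>\<^sub>M borel)"
    and e: "\<And>x j. j < m \<Longrightarrow> e x j \<longleftrightarrow> best_so_far m x t j \<and> Q (x j) (arrival_rank m t j)"
  shows "(\<integral>\<^sup>+x. g (accepted_value m x t (e x)) (opt_value m x) \<partial>PiM {..<m} (\<lambda>_. F))
    = (\<integral>\<^sup>+w. g (seq_value m w Q) (opt_value m w) \<partial>PiM {..<m} (\<lambda>_. F))"
proof -
  let ?P = "PiM {..<m} (\<lambda>_. F)"
  note Fp = is_priorD[OF F]
  let ?r = "arrival_rank m t"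
  let ?s = "the_inv_into {..<m} ?r"
  have [measurable_cong]: "sets ?P = sets (PiM {..<m} (\<lambda>_. borel))"
    using Fp(2) by (intro sets_PiM_cong) auto
  have bij: "bij_betw ?r {..<m} {..<m}" by (rule bij_arrival_rank[OF inj])
  have [measurable]: "(\<lambda>w. seq_value m w Q) \<in> borel_measurable ?P" "opt_value m \<in> borel_measurable ?P"
    using measurable_seq_value[OF Q] by (simp_all cong: measurable_cong_sets)
  note [measurable] = g
  have meas: "(\<lambda>w. g (seq_value m w Q) (opt_value m w)) \<in> borel_measurable ?P"
    by measurable
  have s: "bij_betw ?s {..<m} {..<m}" by (rule bij_betw_the_inv_into[OF bij])
  have "(\<integral>\<^sup>+w. g (seq_value m w Q) (opt_value m w) \<partial>?P)
      = (\<integral>\<^sup>+x. g (seq_value m (\<lambda>l\<in>{..<m}. x (?s l)) Q) (opt_value m (\<lambda>l\<in>{..<m}. x (?s l))) \<partial>?P)"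
    by (rule nn_integral_PiM_permute[OF Fp(1) s meas, symmetric])
  also have "\<dots> = (\<integral>\<^sup>+x. g (accepted_value m x t (e x)) (opt_value m x) \<partial>?P)"
  proof (rule nn_integral_cong)
    fix x assume "x \<in> space ?P"
    let ?w = "\<lambda>l\<in>{..<m}. x (?s l)"
    have x: "x j = ?w (?r j)" if "j < m" for j
      using that arrival_rank_less[OF that] bij by (simp add: the_inv_into_f_f bij_betw_def)
    have "accepted_value m x t (e x) = seq_value m ?w Q"
      by (rule accepted_value_arrival_order[OF inj bij]) (use arrival_rank_less_iff x e in auto)
    moreover have "opt_value m x = opt_value m ?w"
    proof -
      have "x ` {..<m} = (\<lambda>j. ?w (?r j)) ` {..<m}"
        by (intro image_cong refl x) simp
      also have "\<dots> = ?w ` ?r ` {..<m}" by (simp only: image_image)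
      also have "?r ` {..<m} = {..<m}" using bij by (simp add: bij_betw_def)
      finally have "x ` {..<m} = ?w ` {..<m}" .
      then show ?thesis unfolding opt_value_def by (rule arg_cong)
    qed
    ultimately show "g (seq_value m ?w Q) (opt_value m ?w) = g (accepted_value m x t (e x)) (opt_value m x)"
      by simp
  qed
  finally show ?thesis ..
qed


section \<open>Comparison of the two algorithms\<close>

lemma prob_space_instance_space:
  assumes "is_prior F"
  shows "prob_space (instance_space m F)"
proof -
  have "prob_space (PiM {..<m} (\<lambda>_. F))" "prob_space (PiM {..<m} (\<lambda>_. unif01))"
    using assms by (auto intro!: prob_space_PiM prob_space_unif01 is_priorD)
  then show ?thesis unfolding instance_space_def by (rule prob_space_pair)
qed

lemma AE_unif01_inj_on: "AE t in PiM {..<m::nat} (\<lambda>_. unif01). inj_on t {..<m}"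
  by (rule AE_PiM_inj_on[OF prob_space_unif01 sets_unif01 emeasure_unif01_singleton])

text \<open>Given distinct arrival times, the values in order of arrival are again independent draws
  from \<open>F\<close>, so only the order statistics of the times remain.\<close>
lemma nn_integral_instance_arrival_order:
  assumes F: "is_prior F" and g: "case_prod g \<in> borel_measurable (borel \<Otimes>\<^sub>M borel)"
    and A: "A \<in> borel_measurable (instance_space m F)"
    and Q: "\<And>t l. l < m \<Longrightarrow> Measurable.pred borel (\<lambda>v. Q t v l)"
    and e: "\<And>x t. A (x, t) = accepted_value m x t (e x t)"
      "\<And>x t j. j < m \<Longrightarrow> e x t j \<longleftrightarrow> best_so_far m x t j \<and> Q t (x j) (arrival_rank m t j)"
  shows "(\<integral>\<^sup>+\<omega>. g (A \<omega>) (opt_value m (fst \<omega>)) \<partial>instance_space m F)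
    = (\<integral>\<^sup>+t. (\<integral>\<^sup>+w. g (seq_value m w (Q t)) (opt_value m w) \<partial>PiM {..<m} (\<lambda>_. F)) \<partial>PiM {..<m} (\<lambda>_. unif01))"
proof -
  let ?X = "PiM {..<m} (\<lambda>_. F)" and ?T = "PiM {..<m} (\<lambda>_. unif01)"
  interpret X: prob_space ?X using is_priorD(1)[OF F] by (intro prob_space_PiM)
  interpret T: prob_space ?T by (intro prob_space_PiM prob_space_unif01)
  interpret XT: pair_sigma_finite ?X ?T ..
  have "(\<lambda>\<omega>. opt_value m (fst \<omega>)) \<in> borel_measurable (instance_space m F)"
    by (rule measurable_bicrit(2)[OF is_priorD(2)[OF F] F, of "\<lambda>_. 0"]) simp
  from measurable_compose[OF measurable_Pair[OF A this] g]
  have "(\<lambda>\<omega>. g (A \<omega>) (opt_value m (fst \<omega>))) \<in> borel_measurable (?X \<Otimes>\<^sub>M ?T)"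
    by (simp add: instance_space_def)
  from XT.nn_integral_snd[OF this]
  have "(\<integral>\<^sup>+\<omega>. g (A \<omega>) (opt_value m (fst \<omega>)) \<partial>instance_space m F)
      = (\<integral>\<^sup>+t. (\<integral>\<^sup>+x. g (A (x, t)) (opt_value m x) \<partial>?X) \<partial>?T)"
    by (simp add: instance_space_def)
  also have "\<dots> = (\<integral>\<^sup>+t. (\<integral>\<^sup>+w. g (seq_value m w (Q t)) (opt_value m w) \<partial>?X) \<partial>?T)"
  proof (rule nn_integral_cong_AE)
    show "AE t in ?T. (\<integral>\<^sup>+x. g (A (x, t)) (opt_value m x) \<partial>?X)
        = (\<integral>\<^sup>+w. g (seq_value m w (Q t)) (opt_value m w) \<partial>?X)"
      using AE_unif01_inj_on
    proof eventually_elim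
      case (elim t)
      show ?case
        unfolding e(1) by (rule nn_integral_arrival_order[OF F elim Q g e(2)])
    qed
  qed
  finally show ?thesis .
qed

text \<open>The arrival times of the large instance are identified with the internal times
  \<open>t'\<close> of the reduced algorithm, and the values are coupled separately for each
  \<open>t'\<close>. The monotonicity of \<open>g\<close> up to the optimum holds for the accepted
  value itself and also for the indicator of \<open>a = c\<close>: if \<open>a \<le> b\<close>,
  \<open>b \<le> c\<close> and \<open>a = c\<close>, then \<open>b = c\<close>.\<close>

lemma nn_integral_bicrit_le_red:
  assumes F: "is_prior F" and G: "is_prior G" and H: "is_prior H" and G': "is_prior G'"
    and k: "0 < k" and n: "0 < n"
    and cdf_H: "\<And>x. cdf H x = cdf F x powr (1 / real k)"
    and cdf_G': "\<And>x. cdf G' x = cdf G x powr (1 / real k)"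
    and \<theta>: "antimono \<theta>"
    and g: "case_prod g \<in> borel_measurable (borel \<Otimes>\<^sub>M borel)"
    and g_mono: "\<And>a b c. a \<le> b \<Longrightarrow> b \<le> c \<Longrightarrow> g a c \<le> g b c"
  shows "(\<integral>\<^sup>+\<omega>. g (accepted_value (n * k) (fst \<omega>) (snd \<omega>) (bicrit_elig (n * k) G' \<theta> (fst \<omega>) (snd \<omega>)))
          (opt_value (n * k) (fst \<omega>)) \<partial>instance_space (n * k) H)
    \<le> (\<integral>\<^sup>+\<omega>. g (accepted_value n (fst (fst \<omega>)) (snd (fst \<omega>))
            (red_elig n k G \<theta> (fst (fst \<omega>)) (snd (fst \<omega>)) (fst (snd \<omega>)) (snd (snd \<omega>))))
          (opt_value n (fst (fst \<omega>))) \<partial>red_space n k F)"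
    (is "?L \<le> ?R")
proof -
  let ?m = "n * k"
  let ?T = "PiM {..<?m} (\<lambda>_. unif01)" and ?C = "PiM {..<n} (\<lambda>_. uniform_count_measure {..<k})"
  let ?S = "\<lambda>t' v l. \<theta> (sort (map t' [0..<?m]) ! l) < cdf G v powr (1 / real k)"
  let ?I = "instance_space n F"
  let ?A = "\<lambda>\<omega>. accepted_value n (fst (fst \<omega>)) (snd (fst \<omega>))
            (red_elig n k G \<theta> (fst (fst \<omega>)) (snd (fst \<omega>)) (fst (snd \<omega>)) (snd (snd \<omega>)))"
  let ?f = "\<lambda>\<omega>. g (?A \<omega>) (opt_value n (fst (fst \<omega>)))"
  let ?h = "\<lambda>t' c y. g (seq_value n y (\<lambda>v i. ?S t' v (i * k + c i))) (opt_value n y)"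
  have "(\<lambda>x. - \<theta> x) \<in> borel_measurable borel"
    using \<theta> by (intro borel_measurable_mono) (auto simp: mono_def antimono_def)
  then have \<theta>_meas: "\<theta> \<in> borel_measurable borel" by simp
  have S_meas: "Measurable.pred borel (\<lambda>v. ?S t' v l)" for t' l
    by (intro borel_measurable_pred_less powr_real_measurable borel_measurable_const borel_measurable_cdf G)
  interpret T: prob_space ?T by (intro prob_space_PiM prob_space_unif01)
  interpret C: prob_space ?C using k by (intro prob_space_PiM prob_space_uniform_count_measure) auto
  interpret I: prob_space ?I by (rule prob_space_instance_space[OF F])
  interpret Tn: prob_space "PiM {..<n} (\<lambda>_. unif01)" by (intro prob_space_PiM prob_space_unif01)
  interpret TC: pair_sigma_finite ?T ?C ..
  interpret TCp: prob_space "?T \<Otimes>\<^sub>M ?C" by (rule prob_space_pair) unfold_locales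
  interpret ITC: pair_sigma_finite ?I "?T \<Otimes>\<^sub>M ?C" ..

  have "?L = (\<integral>\<^sup>+t'. (\<integral>\<^sup>+w. g (seq_value ?m w (?S t')) (opt_value ?m w) \<partial>PiM {..<?m} (\<lambda>_. H)) \<partial>?T)"
  proof (rule nn_integral_instance_arrival_order[OF H g measurable_bicrit(1)[OF is_priorD(2)[OF H] G' \<theta>_meas] S_meas])
    fix x t j assume j: "j < ?m"
    show "bicrit_elig ?m G' \<theta> x t j \<longleftrightarrow> best_so_far ?m x t j \<and> ?S t (x j) (arrival_rank ?m t j)"
      using sort_nth_arrival_rank[OF j, of t] by (simp add: bicrit_elig_def cdf_G')
  qed simp
  also have "\<dots> \<le> (\<integral>\<^sup>+t'. (\<integral>\<^sup>+c. (\<integral>\<^sup>+y. ?h t' c y \<partial>PiM {..<n} (\<lambda>_. F)) \<partial>?C) \<partial>?T)"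
  proof (rule nn_integral_mono, rule nn_integral_block_coupling[OF H F k n cdf_H])
    fix t' c
    show "?h t' c \<in> borel_measurable (PiM {..<n} (\<lambda>_. borel))"
      using measurable_compose[OF measurable_Pair[OF measurable_seq_value(1) measurable_seq_value(2)] g, of n "\<lambda>v i. ?S t' v (i * k + c i)" "\<lambda>v i. ?S t' v (i * k + c i)"] S_meas
      by simp
    fix w :: "nat \<Rightarrow> real" assume inj: "inj_on w {..<?m}" and arg: "is_block_argmax n k w c"
    have "seq_value ?m w (?S t') \<le> seq_value n (block_max n k w) (\<lambda>v i. ?S t' v (i * k + c i))"
    proof (rule seq_value_le_block[OF arg inj])
      \<comment> \<open>A later position has a larger order statistic, where the antitone \<theta>
        is no larger, and a larger value has a larger cdf.\<close>
      fix v v' l l' assume S: "?S t' v l" and v: "v \<le> v'" and l: "l \<le> l'" "l' < ?m"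
      interpret real_distribution G using G by (simp add: is_prior_def)
      have "sort (map t' [0..<?m]) ! l \<le> sort (map t' [0..<?m]) ! l'"
        using l by (intro sorted_nth_mono) auto
      then have "\<theta> (sort (map t' [0..<?m]) ! l') \<le> \<theta> (sort (map t' [0..<?m]) ! l)"
        by (rule antimonoD[OF \<theta>])
      also have "\<dots> < cdf G v powr (1 / real k)" by (rule S)
      also have "\<dots> \<le> cdf G v' powr (1 / real k)"
        by (intro powr_mono2 cdf_nondecreasing v cdf_nonneg) simp
      finally show "?S t' v' l'" .
    qed
    then show "g (seq_value ?m w (?S t')) (opt_value ?m w) \<le> ?h t' c (block_max n k w)"
      unfolding opt_value_block_max[OF arg]
      by (rule g_mono) (use seq_value_le_opt[of n "block_max n k w"] opt_value_block_max[OF arg] in simp)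
  qed
  also have "\<dots> = ?R"
  proof -
    have f_meas: "?f \<in> borel_measurable (?I \<Otimes>\<^sub>M (?T \<Otimes>\<^sub>M ?C))"
      using measurable_compose[OF measurable_Pair[OF measurable_red[OF is_priorD(2)[OF F] G \<theta>_meas]] g]
      by (simp add: red_space_def)
    \<comment> \<open>The arrival times of the \<open>n\<close> values determine only the ranks.
      Once the values are listed in order of arrival, the integrand is constant in these times,
      whose law has total mass 1.\<close>
    have inner: "(\<integral>\<^sup>+\<omega>. ?f (\<omega>, (t', c)) \<partial>?I) = (\<integral>\<^sup>+y. ?h t' c y \<partial>PiM {..<n} (\<lambda>_. F))"
      if "t' \<in> space ?T" "c \<in> space ?C" for t' c
    proof -
      have A: "(\<lambda>\<omega>. ?A (\<omega>, (t', c))) \<in> borel_measurable ?I"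
      proof (rule measurable_compose[OF measurable_Pair2'])
        show "(t', c) \<in> space (?T \<Otimes>\<^sub>M ?C)" using that by (simp add: space_pair_measure)
        show "?A \<in> borel_measurable (?I \<Otimes>\<^sub>M (?T \<Otimes>\<^sub>M ?C))"
          using measurable_red(1)[OF is_priorD(2)[OF F] G \<theta>_meas, of n k] by (simp add: red_space_def)
      qed
      have "(\<integral>\<^sup>+\<omega>. ?f (\<omega>, (t', c)) \<partial>?I)
          = (\<integral>\<^sup>+t. (\<integral>\<^sup>+y. ?h t' c y \<partial>PiM {..<n} (\<lambda>_. F)) \<partial>PiM {..<n} (\<lambda>_. unif01))"
        unfolding fst_conv snd_conv
        by (rule nn_integral_instance_arrival_order[OF F g A[unfolded fst_conv snd_conv],
              where Q = "\<lambda>_ v i. ?S t' v (i * k + c i)" and e = "\<lambda>x t. red_elig n k G \<theta> x t t' c"])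
           (auto simp: red_elig_def red_time_def intro: S_meas)
      then show ?thesis by (simp add: Tn.emeasure_space_1)
    qed
    have "?R = (\<integral>\<^sup>+z. (\<integral>\<^sup>+\<omega>. ?f (\<omega>, z) \<partial>?I) \<partial>(?T \<Otimes>\<^sub>M ?C))"
      unfolding red_space_def by (rule ITC.nn_integral_snd[OF f_meas, symmetric])
    also have "\<dots> = (\<integral>\<^sup>+t'. (\<integral>\<^sup>+c. (\<integral>\<^sup>+\<omega>. ?f (\<omega>, (t', c)) \<partial>?I) \<partial>?C) \<partial>?T)"
      by (rule C.nn_integral_fst[symmetric])
         (rule I.borel_measurable_nn_integral, rule measurable_pair_swap[OF f_meas])
    also have "\<dots> = (\<integral>\<^sup>+t'. (\<integral>\<^sup>+c. (\<integral>\<^sup>+y. ?h t' c y \<partial>PiM {..<n} (\<lambda>_. F)) \<partial>?C) \<partial>?T)"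
      by (intro nn_integral_cong inner)
    finally show ?thesis ..
  qed
  finally show ?thesis .
qed


section \<open>Thresholds outside the unit interval\<close>

lemma AE_pair_fst:
  assumes "prob_space M" "prob_space N" "AE x in M. P x"
  shows "AE z in M \<Otimes>\<^sub>M N. P (fst z)"
proof -
  interpret M: prob_space M by fact
  interpret N: prob_space N by fact
  obtain A where A: "A \<in> sets M" "emeasure M A = 0" "{x \<in> space M. \<not> P x} \<subseteq> A"
    using assms(3) by (auto elim: AE_E)
  show ?thesis
  proof (rule AE_I)
    show "emeasure (M \<Otimes>\<^sub>M N) (A \<times> space N) = 0" using A by (simp add: N.emeasure_pair_measure_Times)
  qed (use A in \<open>auto simp: space_pair_measure\<close>)
qed

lemma AE_pair_snd:
  assumes "prob_space M" "prob_space N" "AE y in N. P y"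
  shows "AE z in M \<Otimes>\<^sub>M N. P (snd z)"
proof -
  interpret M: prob_space M by fact
  interpret N: prob_space N by fact
  obtain A where A: "A \<in> sets N" "emeasure N A = 0" "{x \<in> space N. \<not> P x} \<subseteq> A"
    using assms(3) by (auto elim: AE_E)
  show ?thesis
  proof (rule AE_I)
    show "emeasure (M \<Otimes>\<^sub>M N) (space M \<times> A) = 0" using A by (simp add: N.emeasure_pair_measure_Times)
  qed (use A in \<open>auto simp: space_pair_measure\<close>)
qed

lemma nn_integral_pair_fst:
  assumes "prob_space N" and f: "f \<in> borel_measurable M"
  shows "(\<integral>\<^sup>+z. f (fst z) \<partial>(M \<Otimes>\<^sub>M N)) = (\<integral>\<^sup>+x. f x \<partial>M)"
proof -
  interpret N: prob_space N by fact
  have "(\<integral>\<^sup>+x. f x \<partial>distr (M \<Otimes>\<^sub>M N) M fst) = (\<integral>\<^sup>+z. f (fst z) \<partial>(M \<Otimes>\<^sub>M N))"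
    by (rule nn_integral_distr[OF measurable_fst]) (use f in simp)
  then show ?thesis by (simp add: N.distr_pair_fst)
qed

text \<open>A threshold function is unconstrained, possibly not even measurable, outside \<open>[0,1]\<close>.\<close>
definition clip_threshold :: "(real \<Rightarrow> real) \<Rightarrow> real \<Rightarrow> real" where
  "clip_threshold \<theta> s = \<theta> (max 0 (min 1 s))"

lemma antimono_clip_threshold: "is_threshold \<theta> \<Longrightarrow> antimono (clip_threshold \<theta>)"
  unfolding antimono_def clip_threshold_def is_threshold_def by (auto simp: max_def min_def)

lemma clip_threshold_eq: "s \<in> {0..1} \<Longrightarrow> clip_threshold \<theta> s = \<theta> s"
  by (simp add: clip_threshold_def)

lemma AE_PiM_unif01: "AE t in PiM {..<m::nat} (\<lambda>_. unif01). \<forall>j<m. t j \<in> {0..1}"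
proof -
  have "AE t in PiM {..<m} (\<lambda>_. unif01). \<forall>j\<in>{..<m}. t j \<in> {0..1}"
    by (intro AE_finite_allI AE_PiM_component prob_space_unif01 AE_unif01) auto
  then show ?thesis by (simp add: Ball_def)
qed

lemma AE_bicrit_clip:
  assumes "is_prior F"
  shows "AE \<omega> in instance_space m F. accepted_value m (fst \<omega>) (snd \<omega>) (bicrit_elig m G (clip_threshold \<theta>) (fst \<omega>) (snd \<omega>))
    = accepted_value m (fst \<omega>) (snd \<omega>) (bicrit_elig m G \<theta> (fst \<omega>) (snd \<omega>))"
proof -
  have "AE \<omega> in instance_space m F. \<forall>j<m. snd \<omega> j \<in> {0..1}"
    unfolding instance_space_def
    by (intro AE_pair_snd AE_PiM_unif01 prob_space_PiM prob_space_unif01 is_priorD(1) assms)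
  then show ?thesis
  proof eventually_elim
    case (elim \<omega>)
    show ?case
      by (rule accepted_value_cong) (use elim in \<open>simp add: bicrit_elig_def clip_threshold_eq\<close>)
  qed
qed

lemma AE_red_clip:
  assumes F: "is_prior F" and k: "0 < k"
  shows "AE \<omega> in red_space n k F. accepted_value n (fst (fst \<omega>)) (snd (fst \<omega>))
        (red_elig n k G (clip_threshold \<theta>) (fst (fst \<omega>)) (snd (fst \<omega>)) (fst (snd \<omega>)) (snd (snd \<omega>)))
    = accepted_value n (fst (fst \<omega>)) (snd (fst \<omega>))
        (red_elig n k G \<theta> (fst (fst \<omega>)) (snd (fst \<omega>)) (fst (snd \<omega>)) (snd (snd \<omega>)))"
proof -
  let ?T = "PiM {..<n * k} (\<lambda>_. unif01)" and ?C = "PiM {..<n} (\<lambda>_. uniform_count_measure {..<k})"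
  have T: "prob_space ?T" by (intro prob_space_PiM prob_space_unif01)
  have C: "prob_space ?C" using k by (intro prob_space_PiM prob_space_uniform_count_measure) auto
  have "AE z in ?T \<Otimes>\<^sub>M ?C. \<forall>j<n * k. fst z j \<in> {0..1}"
    by (intro AE_pair_fst T C AE_PiM_unif01)
  then have "AE \<omega> in red_space n k F. \<forall>j<n * k. fst (snd \<omega>) j \<in> {0..1}"
    unfolding red_space_def
    by (intro AE_pair_snd[where P = "\<lambda>z. \<forall>j<n * k. fst z j \<in> {0..1}"] prob_space_instance_space F prob_space_pair T C)
  then show ?thesis
    using AE_space
  proof eventually_elim
    case (elim \<omega>)
    have ch: "snd (snd \<omega>) r < k" if "r < n" for r
      using elim(2) that by (auto simp: red_space_def space_pair_measure space_PiM space_uniform_count_measure)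
    have "red_time n k (fst (snd \<omega>)) (snd (snd \<omega>)) r \<in> {0..1}" if r: "r < n" for r
    proof -
      let ?xs = "map (fst (snd \<omega>)) [0..<n * k]"
      have "sort ?xs ! (r * k + snd (snd \<omega>) r) \<in> set (sort ?xs)"
        using block_index_less[OF r ch[OF r]] by (intro nth_mem) simp
      then show ?thesis unfolding red_time_def using elim(1) by auto
    qed
    then show ?case
      by (intro accepted_value_cong) (simp add: red_elig_def clip_threshold_eq arrival_rank_less)
  qed
qed

text \<open>All times involved lie in \<open>[0,1]\<close> almost surely, so clipping changes both
  integrands only on null sets. \<open>nn_integral\<close> ignores such changes even for
  non-measurable integrands.\<close>

lemma nn_integral_bicrit_le_red_threshold:
  assumes F: "is_prior F" and G: "is_prior G" and H: "is_prior H" and G': "is_prior G'"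
    and k: "0 < k" and n: "0 < n"
    and cdf_H: "\<And>x. cdf H x = cdf F x powr (1 / real k)"
    and cdf_G': "\<And>x. cdf G' x = cdf G x powr (1 / real k)"
    and \<theta>: "is_threshold \<theta>"
    and g: "case_prod g \<in> borel_measurable (borel \<Otimes>\<^sub>M borel)"
    and g_mono: "\<And>a b c. a \<le> b \<Longrightarrow> b \<le> c \<Longrightarrow> g a c \<le> g b c"
  shows "(\<integral>\<^sup>+\<omega>. g (accepted_value (n * k) (fst \<omega>) (snd \<omega>) (bicrit_elig (n * k) G' \<theta> (fst \<omega>) (snd \<omega>)))
          (opt_value (n * k) (fst \<omega>)) \<partial>instance_space (n * k) H)
    \<le> (\<integral>\<^sup>+\<omega>. g (accepted_value n (fst (fst \<omega>)) (snd (fst \<omega>))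
            (red_elig n k G \<theta> (fst (fst \<omega>)) (snd (fst \<omega>)) (fst (snd \<omega>)) (snd (snd \<omega>))))
          (opt_value n (fst (fst \<omega>))) \<partial>red_space n k F)"
proof -
  have "(\<integral>\<^sup>+\<omega>. g (accepted_value (n * k) (fst \<omega>) (snd \<omega>) (bicrit_elig (n * k) G' \<theta> (fst \<omega>) (snd \<omega>)))
          (opt_value (n * k) (fst \<omega>)) \<partial>instance_space (n * k) H)
      = (\<integral>\<^sup>+\<omega>. g (accepted_value (n * k) (fst \<omega>) (snd \<omega>) (bicrit_elig (n * k) G' (clip_threshold \<theta>) (fst \<omega>) (snd \<omega>)))
          (opt_value (n * k) (fst \<omega>)) \<partial>instance_space (n * k) H)"
    by (rule nn_integral_cong_AE, rule eventually_mono[OF AE_bicrit_clip[OF H, of "n * k" G' \<theta>]]) simp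
  also note nn_integral_bicrit_le_red[OF F G H G' k n cdf_H cdf_G' antimono_clip_threshold[OF \<theta>] g g_mono]
  also have "(\<integral>\<^sup>+\<omega>. g (accepted_value n (fst (fst \<omega>)) (snd (fst \<omega>))
            (red_elig n k G (clip_threshold \<theta>) (fst (fst \<omega>)) (snd (fst \<omega>)) (fst (snd \<omega>)) (snd (snd \<omega>))))
          (opt_value n (fst (fst \<omega>))) \<partial>red_space n k F)
      = (\<integral>\<^sup>+\<omega>. g (accepted_value n (fst (fst \<omega>)) (snd (fst \<omega>))
            (red_elig n k G \<theta> (fst (fst \<omega>)) (snd (fst \<omega>)) (fst (snd \<omega>)) (snd (snd \<omega>))))
          (opt_value n (fst (fst \<omega>))) \<partial>red_space n k F)"
    by (rule nn_integral_cong_AE, rule eventually_mono[OF AE_red_clip[OF F k, of n G \<theta>]]) simp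
  finally show ?thesis .
qed

text \<open>The MaxExp ratio also needs equal denominators: the overall maximum is the maximum of
  the block maxima, which have law \<open>F\<close>.\<close>

lemma nn_integral_opt_value_eq:
  assumes F: "is_prior F" and H: "is_prior H" and k: "0 < k" and n: "0 < n"
    and cdf: "\<And>x. cdf H x = cdf F x powr (1 / real k)"
  shows "(\<integral>\<^sup>+\<omega>. ennreal (opt_value (n * k) (fst \<omega>)) \<partial>instance_space (n * k) H)
    = (\<integral>\<^sup>+\<omega>. ennreal (opt_value n (fst (fst \<omega>))) \<partial>red_space n k F)"
proof -
  let ?P = "PiM {..<n * k} (\<lambda>_. H)"
  have opt: "(\<lambda>w. ennreal (opt_value m w)) \<in> borel_measurable (PiM {..<m} (\<lambda>_. D))"
    if "sets D = sets borel" for m and D :: "real measure"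
  proof -
    have "sets (PiM {..<m} (\<lambda>_. D)) = sets (PiM {..<m} (\<lambda>_. borel))"
      using that by (intro sets_PiM_cong) auto
    then have "opt_value m \<in> borel_measurable (PiM {..<m} (\<lambda>_. D))"
      using measurable_seq_value(2)[of m "\<lambda>_ _. True"] by (simp cong: measurable_cong_sets)
    then show ?thesis by measurable
  qed
  have bm: "block_max n k \<in> ?P \<rightarrow>\<^sub>M PiM {..<n} (\<lambda>_. borel)"
  proof -
    have "sets ?P = sets (PiM {..<n * k} (\<lambda>_. borel))"
      using is_priorD(2)[OF H] by (intro sets_PiM_cong) auto
    then show ?thesis using measurable_block_max[OF k, of n] by (simp cong: measurable_cong_sets)
  qed
  have U: "prob_space (PiM {..<m::nat} (\<lambda>_. unif01))" for m
    by (intro prob_space_PiM prob_space_unif01)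
  have C: "prob_space (PiM {..<n} (\<lambda>_. uniform_count_measure {..<k}))"
    using k by (intro prob_space_PiM prob_space_uniform_count_measure) auto
  have "(\<integral>\<^sup>+\<omega>. ennreal (opt_value n (fst (fst \<omega>))) \<partial>red_space n k F)
      = (\<integral>\<^sup>+\<omega>. ennreal (opt_value n (fst \<omega>)) \<partial>instance_space n F)"
    unfolding red_space_def
  proof (rule nn_integral_pair_fst[where f = "\<lambda>\<omega>. ennreal (opt_value n (fst \<omega>))"])
    show "(\<lambda>\<omega>. ennreal (opt_value n (fst \<omega>))) \<in> borel_measurable (instance_space n F)"
      unfolding instance_space_def by (rule measurable_compose[OF measurable_fst opt[OF is_priorD(2)[OF F]]])
  qed (intro prob_space_pair U C)
  also have "\<dots> = (\<integral>\<^sup>+y. ennreal (opt_value n y) \<partial>PiM {..<n} (\<lambda>_. F))"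
    unfolding instance_space_def
    by (rule nn_integral_pair_fst[OF U opt[OF is_priorD(2)[OF F]]])
  also have "\<dots> = (\<integral>\<^sup>+w. ennreal (opt_value n (block_max n k w)) \<partial>?P)"
    unfolding distr_block_max[OF H F k n cdf, symmetric]
    by (rule nn_integral_distr[OF bm]) (use opt[of borel n] in simp)
  also have "\<dots> = (\<integral>\<^sup>+w. ennreal (opt_value (n * k) w) \<partial>?P)"
    by (metis is_block_argmax_exists[OF k] opt_value_block_max)
  also have "\<dots> = (\<integral>\<^sup>+\<omega>. ennreal (opt_value (n * k) (fst \<omega>)) \<partial>instance_space (n * k) H)"
    unfolding instance_space_def
    by (rule nn_integral_pair_fst[OF U opt[OF is_priorD(2)[OF H]], symmetric])
  finally show ?thesis ..
qed


section \<open>Measurability of the winning event for arbitrary thresholds\<close>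

lemma cdf_prior_attains:
  assumes G: "is_prior G" and c: "0 < c" "c < 1"
  obtains a where "0 < a" "cdf G a = c"
proof -
  interpret real_distribution G using G by (simp add: is_prior_def)
  have "eventually (\<lambda>b. c < cdf G b) at_top"
    by (rule order_tendstoD(1)[OF cdf_lim_at_top_prob c(2)])
  then obtain b where b: "\<And>b'. b \<le> b' \<Longrightarrow> c < cdf G b'" by (auto simp: eventually_at_top_linorder)
  have "\<exists>a. 0 \<le> a \<and> a \<le> max 0 b \<and> cdf G a = c"
  proof (rule IVT')
    show "cdf G 0 \<le> c" "c \<le> cdf G (max 0 b)" "0 \<le> max 0 b"
      using c b[of "max 0 b"] cdf_prior_nonpos[OF G, of 0] by auto
    show "continuous_on {0..max 0 b} (cdf G)"
      using G by (intro continuous_at_imp_continuous_on) (simp add: is_prior_def)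
  qed
  then obtain a where "0 \<le> a" "cdf G a = c" by blast
  moreover have "a \<noteq> 0" using \<open>cdf G a = c\<close> c cdf_prior_nonpos[OF G, of 0] by auto
  ultimately show ?thesis by (intro that) auto
qed

text \<open>Every point of \<open>P\<close> below some rational in \<open>D\<close> is covered by
  one of countably many Borel pieces. The remainder \<open>R\<close> has at most one point, a
  largest element of \<open>P\<close>, because a rational fits between any two points.\<close>

lemma borel_if_initial_segments_borel:
  fixes P :: "real set"
  assumes "\<And>p. p \<in> P \<Longrightarrow> P \<inter> {..<p} \<in> sets borel"
  shows "P \<in> sets borel"
proof -
  define D where "D = {q \<in> \<rat>. \<exists>p\<in>P. q \<le> p}"
  define R where "R = P - (\<Union>q\<in>D. P \<inter> {..<q})"
  have D: "P \<inter> {..<q} \<in> sets borel" if "q \<in> D" for q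
  proof -
    from that obtain p where p: "p \<in> P" "q \<le> p" by (auto simp: D_def)
    then have "P \<inter> {..<q} = (P \<inter> {..<p}) \<inter> {..<q}" by auto
    also have "\<dots> \<in> sets borel" using assms[OF p(1)] by auto
    finally show ?thesis .
  qed
  have less: "\<not> a < b" if "a \<in> R" "b \<in> R" for a b
  proof
    assume "a < b"
    then obtain q where q: "q \<in> \<rat>" "a < q" "q < b" using Rats_dense_in_real by blast
    then have "q \<in> D" using \<open>b \<in> R\<close> by (auto simp: D_def R_def intro!: bexI[of _ b])
    then show False using \<open>a \<in> R\<close> \<open>a < q\<close> by (auto simp: R_def)
  qed
  have "R \<in> sets borel"
  proof (cases "R = {}")
    case False
    then obtain a where "a \<in> R" by blast
    then have "R = {a}" using less by (metis linorder_less_linear equalityI insert_subset singletonD subsetI empty_subsetI)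
    then show ?thesis by simp
  qed simp
  moreover have "countable D" unfolding D_def using countable_rat by (rule countable_subset[rotated]) auto
  then have "(\<Union>q\<in>D. P \<inter> {..<q}) \<in> sets borel" using D by (intro sets.countable_UN') auto
  moreover have "P = R \<union> (\<Union>q\<in>D. P \<inter> {..<q})" by (auto simp: R_def)
  ultimately show ?thesis by (metis sets.Un)
qed

text \<open>Measurability of the winning event forces measurability of the relevant sublevel sets of the
  threshold, by restricting to sections in which a single arrival time varies.\<close>
lemma
  assumes F: "is_prior F" and G: "is_prior G" and \<theta>: "is_threshold \<theta>"
    and B: "{\<omega> \<in> space (instance_space m F). accepted_value m (fst \<omega>) (snd \<omega>) (bicrit_elig m G \<theta> (fst \<omega>) (snd \<omega>)) = opt_value m (fst \<omega>)}
      \<in> sets (instance_space m F)"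
  shows borel_threshold_sublevel: "1 \<le> m \<Longrightarrow> 0 < c \<Longrightarrow> c < 1 \<Longrightarrow> {s. \<theta> s < c} \<in> sets borel"
    and borel_threshold_negative: "2 \<le> m \<Longrightarrow> {s. \<theta> s < 0} \<in> sets borel"
proof -
  let ?M = "instance_space m F"
  let ?W = "\<lambda>x t. accepted_value m x t (bicrit_elig m G \<theta> x t) = opt_value m x"
  have \<theta>_half: "0 \<le> \<theta> (1 / 2)" using \<theta> by (auto simp: is_threshold_def)
  have cdf0: "cdf G 0 = 0" using cdf_prior_nonpos[OF G, of 0] by simp
  \<comment> \<open>All values and all times but that of index 0 are frozen. The free time
    \<open>s\<close> ranges over the whole line, since \<open>unif01\<close> lives on all
    reals.\<close>
  have sect: "{s. ?W x (\<lambda>j\<in>{..<m}. if j = 0 then s else t j)} \<in> sets borel"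
    if x: "x \<in> extensional {..<m}" for x t
  proof -
    let ?t = "\<lambda>s. \<lambda>j\<in>{..<m}. if j = 0 then s else t j"
    have x': "x \<in> space (PiM {..<m} (\<lambda>_. borel))" using x by (simp add: space_PiM PiE_def)
    have "?t \<in> borel \<rightarrow>\<^sub>M PiM {..<m} (\<lambda>_. borel)"
      by (rule measurable_restrict) simp
    then have "(\<lambda>s. (x, ?t s)) \<in> borel \<rightarrow>\<^sub>M PiM {..<m} (\<lambda>_. borel) \<Otimes>\<^sub>M PiM {..<m} (\<lambda>_. borel)"
      by (rule measurable_Pair[OF measurable_const[OF x']])
    then have sm: "(\<lambda>s. (x, ?t s)) \<in> borel \<rightarrow>\<^sub>M ?M"
      by (simp add: sets_instance_space[OF is_priorD(2)[OF F]] cong: measurable_cong_sets)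
    from measurable_sets[OF this B] measurable_space[OF this] show ?thesis
      by (simp add: vimage_def)
  qed
  show sub: "{s. \<theta> s < c} \<in> sets borel" if m: "1 \<le> m" and c: "0 < c" "c < 1" for c
  proof -
    obtain a where a: "0 < a" "cdf G a = c" using cdf_prior_attains[OF G c] .
    \<comment> \<open>The single positive value sits exactly at level \<open>c\<close> and arrives
      at \<open>s\<close>. The zeros arrive at \<open>1 / 2\<close>, a point of \<open>[0,1]\<close>
      where \<theta> is known to be nonnegative, so they are never eligible. Hence the rule wins
      exactly when \<open>\<theta> s < c\<close>.\<close>
    define x where "x = (\<lambda>j\<in>{..<m}. if j = 0 then a else 0)"
    define t where "t s = (\<lambda>j\<in>{..<m}. if j = 0 then s else 1 / 2)" for s :: real
    have x: "x 0 = a" "\<And>j. 0 < j \<Longrightarrow> j < m \<Longrightarrow> x j = 0" using m by (auto simp: x_def)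
    have t: "t s 0 = s" "\<And>j. 0 < j \<Longrightarrow> j < m \<Longrightarrow> t s j = 1 / 2" for s using m by (auto simp: t_def)
    have xle: "x j \<le> a" if "j < m" for j using x that a by (cases "j = 0") auto
    have opt: "opt_value m x = a"
      unfolding opt_value_def using m a x xle by (intro Max_eqI) force+
    have el0: "bicrit_elig m G \<theta> x (t s) 0 \<longleftrightarrow> \<theta> s < c" for s
      using xle x a t by (auto simp: bicrit_elig_def best_so_far_iff)
    have elj: "\<not> bicrit_elig m G \<theta> x (t s) j" if "j < m" "j \<noteq> 0" for s j
    proof -
      have xj: "x j = 0" and tj: "t s j = 1 / 2" using that x(2) t(2) by auto
      show ?thesis unfolding bicrit_elig_def xj tj cdf0 using \<theta>_half by simp
    qed
    have "?W x (t s) \<longleftrightarrow> \<theta> s < c" for s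
    proof (cases "\<theta> s < c")
      case True
      have "accepted_value m x (t s) (bicrit_elig m G \<theta> x (t s)) = x 0"
        by (rule accepted_value_strictly_first) (use m True el0 elj in auto)
      then show ?thesis using True opt x by simp
    next
      case False
      have "accepted_value m x (t s) (bicrit_elig m G \<theta> x (t s)) = 0"
        by (rule accepted_value_none) (use False el0 elj in metis)
      then show ?thesis using False opt a by simp
    qed
    then show ?thesis using sect[of x "\<lambda>_. 1 / 2"] by (simp add: t_def x_def)
  qed
  show "{s. \<theta> s < 0} \<in> sets borel" if m: "2 \<le> m"
  proof (rule borel_if_initial_segments_borel)
    fix s' assume "s' \<in> {s. \<theta> s < 0}"
    then have s': "\<theta> s' < 1 / 2" by simp
    obtain a where a: "0 < a" "cdf G a = 1 / 2" using cdf_prior_attains[OF G, of "1 / 2"] by auto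
    \<comment> \<open>A value 0 arriving at \<open>s\<close> acts as a decoy. The positive value
      arrives at \<open>s'\<close>, chosen in the set under study so that it is eligible there. For
      \<open>s < s'\<close> the decoy is taken, and the rule loses, exactly when
      \<open>\<theta> s < 0\<close>; this decides membership only to the left of
      \<open>s'\<close>.\<close>
    define x where "x = (\<lambda>j\<in>{..<m}. if j = 1 then a else 0)"
    define t where "t s = (\<lambda>j\<in>{..<m}. if j = 0 then s else if j = 1 then s' else 1 / 2)" for s :: real
    have x: "x 0 = 0" "x 1 = a" "\<And>j. 1 < j \<Longrightarrow> j < m \<Longrightarrow> x j = 0" using m by (auto simp: x_def)
    have t: "t s 0 = s" "t s 1 = s'" "\<And>j. 1 < j \<Longrightarrow> j < m \<Longrightarrow> t s j = 1 / 2" for s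
      using m by (auto simp: t_def)
    have cases: "j = 0 \<or> j = 1 \<or> 1 < j" for j :: nat by auto
    have xle: "x j \<le> a" if "j < m" for j using x that a cases[of j] by auto
    have opt: "opt_value m x = a"
      unfolding opt_value_def
    proof (rule Max_eqI)
      show "a \<in> insert 0 (x ` {..<m})" using x(2) m by (intro insertI2 image_eqI[of _ _ 1]) auto
    qed (use xle a in auto)
    have el1: "bicrit_elig m G \<theta> x (t s) 1" for s
      using xle x a t s' by (auto simp: bicrit_elig_def best_so_far_iff)
    have el0: "bicrit_elig m G \<theta> x (t s) 0 \<longleftrightarrow> \<theta> s < 0" if "s < s'" for s
    proof -
      have "x j \<le> 0" if "j < m" "t s j < s" for j
        using cases[of j] x t that \<open>s < s'\<close> by force
      then have "best_so_far m x (t s) 0" by (auto simp: best_so_far_iff x t)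
      then show ?thesis by (simp add: bicrit_elig_def x t cdf0)
    qed
    have elj: "\<not> bicrit_elig m G \<theta> x (t s) j" if "j < m" "1 < j" for s j
    proof -
      have xj: "x j = 0" and tj: "t s j = 1 / 2" using that x(3) t(3) by auto
      show ?thesis unfolding bicrit_elig_def xj tj cdf0 using \<theta>_half by simp
    qed
    have W: "?W x (t s) \<longleftrightarrow> \<not> \<theta> s < 0" if s: "s < s'" for s
    proof (cases "\<theta> s < 0")
      case True
      have "accepted_value m x (t s) (bicrit_elig m G \<theta> x (t s)) = x 0"
      proof (rule accepted_value_strictly_first)
        fix j assume "j < m" "bicrit_elig m G \<theta> x (t s) j" "j \<noteq> 0"
        then have "j = 1" using elj[of j s] cases[of j] by blast
        then show "t s 0 < t s j" using t s by simp
      qed (use m True el0[OF s] in auto)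
      then show ?thesis using True opt x a by simp
    next
      case False
      have "accepted_value m x (t s) (bicrit_elig m G \<theta> x (t s)) = x 1"
      proof (rule accepted_value_strictly_first)
        fix j assume "j < m" "bicrit_elig m G \<theta> x (t s) j" "j \<noteq> 1"
        then show "t s 1 < t s j" using elj[of j s] cases[of j] el0[OF s] False by blast
      qed (use m el1 in auto)
      then show ?thesis using False opt x by simp
    qed
    have "{s. ?W x (t s)} \<in> sets borel"
      using sect[of x "\<lambda>j. if j = 1 then s' else 1 / 2"] by (simp add: t_def x_def)
    then have "{..<s'} - {s. ?W x (t s)} \<in> sets borel" by auto
    also have "{..<s'} - {s. ?W x (t s)} = {s. \<theta> s < 0} \<inter> {..<s'}" using W by auto
    finally show "{s. \<theta> s < 0} \<inter> {..<s'} \<in> sets borel" .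
  qed
qed

text \<open>Only thresholds compared with levels in \<open>[0,1]\<close> matter; for a single value, level \<open>0\<close> is
  irrelevant because accepting the value \<open>0\<close> is the same as accepting nothing.\<close>
lemma measurable_red_if_bicrit_measurable:
  assumes F: "is_prior F" and G: "is_prior G" and H: "is_prior H" and G': "is_prior G'"
    and k: "0 < k" and n: "0 < n" and \<theta>: "is_threshold \<theta>"
    and B: "{\<omega> \<in> space (instance_space (n * k) H). accepted_value (n * k) (fst \<omega>) (snd \<omega>) (bicrit_elig (n * k) G' \<theta> (fst \<omega>) (snd \<omega>)) = opt_value (n * k) (fst \<omega>)}
      \<in> sets (instance_space (n * k) H)"
  shows "(\<lambda>\<omega>. accepted_value n (fst (fst \<omega>)) (snd (fst \<omega>))
        (red_elig n k G \<theta> (fst (fst \<omega>)) (snd (fst \<omega>)) (fst (snd \<omega>)) (snd (snd \<omega>))))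
      \<in> borel_measurable (red_space n k F)"
proof -
  define h where "h s = max 0 (min 1 (\<theta> s))" for s
  \<comment> \<open>The levels compared with the threshold lie in \<open>[0,1]\<close>. Clipping to
    \<open>h\<close> preserves the comparisons with positive levels but merges negative thresholds
    with 0; the value \<open>- 1\<close> restores the comparison with level 0.\<close>
  define \<theta>' where "\<theta>' s = (if 2 \<le> n * k \<and> \<theta> s < 0 then - 1 else h s)" for s
  have nk: "1 \<le> n * k" using n k by (simp add: Suc_le_eq)
  have h_meas: "h \<in> borel_measurable borel"
    unfolding borel_measurable_iff_less
  proof
    fix a :: real
    consider "a \<le> 0" | "0 < a" "a \<le> 1" | "1 < a" by linarith
    then have "{s. h s < a} \<in> sets borel"
    proof cases
      case 1
      then have "{s. h s < a} = {}" by (auto simp: h_def)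
      then show ?thesis by simp
    next
      case 2
      \<comment> \<open>Sublevel sets are available only for levels strictly between 0 and 1;
        rational approximation from below also reaches \<open>a = 1\<close>.\<close>
      have "{s. h s < a} = (\<Union>q\<in>\<rat> \<inter> {0<..<a}. {s. \<theta> s < q})"
      proof (intro set_eqI iffI)
        fix s assume "s \<in> {s. h s < a}"
        then have "max 0 (\<theta> s) < a" using 2 by (auto simp: h_def max_def min_def split: if_splits)
        then obtain q where "q \<in> \<rat>" "max 0 (\<theta> s) < q" "q < a" using Rats_dense_in_real by blast
        then show "s \<in> (\<Union>q\<in>\<rat> \<inter> {0<..<a}. {s. \<theta> s < q})" by auto
      qed (use 2 in \<open>auto simp: h_def\<close>)
      also have "\<dots> \<in> sets borel"
      proof (rule sets.countable_UN')
        show "countable (\<rat> \<inter> {0<..<a})" using countable_rat by (rule countable_subset[rotated]) auto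
      qed (use 2 in \<open>auto intro!: borel_threshold_sublevel[OF H G' \<theta> B nk]\<close>)
      finally show ?thesis .
    next
      case 3
      then have "{s. h s < a} = UNIV" by (auto simp: h_def)
      then show ?thesis by simp
    qed
    then show "{s \<in> space borel. h s < a} \<in> sets borel" by simp
  qed
  have \<theta>'_meas: "\<theta>' \<in> borel_measurable borel"
    unfolding \<theta>'_def
  proof (rule measurable_If[OF borel_measurable_const h_meas])
    show "{s \<in> space borel. 2 \<le> n * k \<and> \<theta> s < 0} \<in> sets borel"
      using borel_threshold_negative[OF H G' \<theta> B] by (cases "2 \<le> n * k") auto
  qed
  interpret real_distribution G using G by (simp add: is_prior_def)
  define p where "p v = cdf G v powr (1 / real k)" for v
  have p: "0 \<le> p v" "p v \<le> 1" for v
    using powr_mono2[of "1 / real k" "cdf G v" 1] cdf_nonneg[of v] cdf_bounded_prob[of v] by (auto simp: p_def)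
  have level: "\<theta> s < p v \<longleftrightarrow> \<theta>' s < p v" if "2 \<le> n * k \<or> 0 < p v" for s v
    using p[of v] that by (auto simp: \<theta>'_def h_def max_def min_def split: if_splits)
  have "accepted_value n x t (red_elig n k G \<theta> x t t' c) = accepted_value n x t (red_elig n k G \<theta>' x t t' c)" for x t t' c
  proof (cases "2 \<le> n * k \<or> 0 < p (x 0)")
    case True
    have "2 \<le> n * k \<or> j = 0" if "j < n" for j
    proof -
      have "n * 1 \<le> n * k" using k by (intro mult_le_mono2) simp
      then show ?thesis using that by linarith
    qed
    then show ?thesis
      using True level by (intro accepted_value_cong) (auto simp: red_elig_def p_def[symmetric])
  next
    case False
    then have "n = 1" "k = 1" using nk n k by (auto simp: not_le numeral_2_eq_2 less_Suc_eq)
    have "cdf G (x 0) = 0" using False p(1)[of "x 0"] \<open>k = 1\<close> cdf_nonneg[of "x 0"] by (simp add: p_def)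
    then have "x 0 \<le> 0"
      using G strict_mono_onD[of "{0..}" "cdf G" 0 "x 0"] by (auto simp: is_prior_def not_le[symmetric])
    have zero: "accepted_value n x t (red_elig n k G f x t t' c) = 0" for f
    proof (cases "red_elig n k G f x t t' c 0")
      case True
      then have "x 0 = 0" using \<open>x 0 \<le> 0\<close> by (auto simp: red_elig_def best_so_far_iff)
      moreover have "accepted_value n x t (red_elig n k G f x t t' c) = x 0"
        by (rule accepted_value_strictly_first) (use True \<open>n = 1\<close> in auto)
      ultimately show ?thesis by simp
    next
      case False
      then show ?thesis using \<open>n = 1\<close> by (intro accepted_value_none) auto
    qed
    then show ?thesis by simp
  qed
  then show ?thesis using measurable_red(1)[OF is_priorD(2)[OF F] G \<theta>'_meas, of n k] by simp
qed

lemma bicrit_competitive_imp_red_competitive: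
  assumes F: "is_prior F" and G: "is_prior G" and H: "is_prior H" and G': "is_prior G'"
    and k: "0 < k" and n: "0 < n" and \<theta>: "is_threshold \<theta>"
    and cdf_H: "\<And>x. cdf H x = cdf F x powr (1 / real k)"
    and cdf_G': "\<And>x. cdf G' x = cdf G x powr (1 / real k)"
    and comp: "bicrit_competitive obj (n * k) \<theta> H G' c"
  shows "red_competitive obj n k \<theta> F G c"
proof (cases obj)
  case MaxExp
  have "ennreal c * (\<integral>\<^sup>+\<omega>. ennreal (opt_value n (fst (fst \<omega>))) \<partial>red_space n k F)
      \<le> (\<integral>\<^sup>+\<omega>. ennreal (accepted_value (n * k) (fst \<omega>) (snd \<omega>) (bicrit_elig (n * k) G' \<theta> (fst \<omega>) (snd \<omega>))) \<partial>instance_space (n * k) H)"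
    using comp unfolding MaxExp bicrit_competitive_def competitive_def nn_integral_opt_value_eq[OF F H k n cdf_H, symmetric]
    by (simp add: case_prod_unfold)
  also note nn_integral_bicrit_le_red_threshold[OF F G H G' k n cdf_H cdf_G' \<theta>, of "\<lambda>a _. ennreal a"]
  finally show ?thesis
    unfolding MaxExp red_competitive_def competitive_def by (simp add: case_prod_unfold ennreal_leI)
next
  case MaxProb
  let ?I = "instance_space (n * k) H" and ?R = "red_space n k F"
  let ?b = "\<lambda>\<omega>. accepted_value (n * k) (fst \<omega>) (snd \<omega>) (bicrit_elig (n * k) G' \<theta> (fst \<omega>) (snd \<omega>))"
  let ?r = "\<lambda>\<omega>. accepted_value n (fst (fst \<omega>)) (snd (fst \<omega>))
        (red_elig n k G \<theta> (fst (fst \<omega>)) (snd (fst \<omega>)) (fst (snd \<omega>)) (snd (snd \<omega>)))"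
  let ?B = "{\<omega> \<in> space ?I. ?b \<omega> = opt_value (n * k) (fst \<omega>)}"
  let ?A = "{\<omega> \<in> space ?R. ?r \<omega> = opt_value n (fst (fst \<omega>))}"
  \<comment> \<open>The indicator of winning, as a payoff that can be compared by integrals.\<close>
  let ?g = "\<lambda>a b. if a = b then 1 else (0::ennreal)"
  have c: "c \<le> measure ?I ?B"
    using comp by (simp add: MaxProb bicrit_competitive_def competitive_def case_prod_unfold)
  have "c \<le> measure ?R ?A"
  proof (cases "c \<le> 0")
    case True
    then show ?thesis using measure_nonneg[of ?R ?A] by linarith
  next
    case False
    \<comment> \<open>\<open>measure\<close> is 0 on non-measurable sets, so a positive lower bound
      certifies measurability.\<close>
    then have B: "?B \<in> sets ?I" using c measure_notin_sets by force
    interpret I: prob_space ?I by (rule prob_space_instance_space[OF H])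
    interpret R: prob_space ?R
      unfolding red_space_def using k
      by (intro prob_space_pair prob_space_instance_space F prob_space_PiM prob_space_unif01 prob_space_uniform_count_measure) auto
    note [measurable] = measurable_red_if_bicrit_measurable[OF F G H G' k n \<theta> B]
      measurable_red(2)[OF is_priorD(2)[OF F] G, of "\<lambda>_. 0", simplified]
    have A: "?A \<in> sets ?R" by measurable
    have "emeasure ?I ?B = (\<integral>\<^sup>+\<omega>. ?g (?b \<omega>) (opt_value (n * k) (fst \<omega>)) \<partial>?I)"
      unfolding nn_integral_indicator[OF B, symmetric] by (rule nn_integral_cong) (simp add: indicator_def)
    also have "\<dots> \<le> (\<integral>\<^sup>+\<omega>. ?g (?r \<omega>) (opt_value n (fst (fst \<omega>))) \<partial>?R)"
      by (rule nn_integral_bicrit_le_red_threshold[OF F G H G' k n cdf_H cdf_G' \<theta>]) auto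
    also have "\<dots> = emeasure ?R ?A"
      unfolding nn_integral_indicator[OF A, symmetric] by (rule nn_integral_cong) (simp add: indicator_def)
    finally have "measure ?I ?B \<le> measure ?R ?A"
      by (simp add: I.emeasure_eq_measure R.emeasure_eq_measure)
    then show ?thesis using c by simp
  qed
  then show ?thesis by (simp add: MaxProb red_competitive_def competitive_def case_prod_unfold)
qed

theorem mainTheorem7:
  fixes n k :: nat and \<theta> :: "real \<Rightarrow> real" and obj :: objective and \<alpha> \<beta> :: real
  assumes "n \<ge> 1" and "k \<ge> 1" and "is_threshold \<theta>"
    and "\<forall>F. is_prior F \<longrightarrow> bicrit_competitive obj (n * k) \<theta> F F \<alpha>"
    and "\<forall>F G. is_prior F \<longrightarrow> is_prior G \<longrightarrow> bicrit_competitive obj (n * k) \<theta> F G \<beta>"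
  shows "(\<forall>F. is_prior F \<longrightarrow> red_competitive obj n k \<theta> F F \<alpha>)
       \<and> (\<forall>F G. is_prior F \<longrightarrow> is_prior G \<longrightarrow> red_competitive obj n k \<theta> F G \<beta>)"
proof -
  have n: "0 < n" and k: "0 < k" using assms(1,2) by auto
  show ?thesis
  proof (intro conjI allI impI)
    fix F assume F: "is_prior F"
    obtain H where H: "is_prior H" "\<And>x. cdf H x = cdf F x powr (1 / real k)"
      using root_prior_exists[OF F k] by blast
    \<comment> \<open>One root \<open>H\<close> serves as prior and as prediction, so the prediction
      is exact on the large instance too.\<close>
    show "red_competitive obj n k \<theta> F F \<alpha>"
      using assms(4) H
      by (intro bicrit_competitive_imp_red_competitive[OF F F H(1) H(1) k n assms(3)]) auto
  next
    fix F G assume F: "is_prior F" and G: "is_prior G"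
    obtain H where H: "is_prior H" "\<And>x. cdf H x = cdf F x powr (1 / real k)"
      using root_prior_exists[OF F k] by blast
    obtain G' where G': "is_prior G'" "\<And>x. cdf G' x = cdf G x powr (1 / real k)"
      using root_prior_exists[OF G k] by blast
    show "red_competitive obj n k \<theta> F G \<beta>"
      using assms(5) H G'
      by (intro bicrit_competitive_imp_red_competitive[OF F G H(1) G'(1) k n assms(3)]) auto
  qed
qed

end
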